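(* For every $0<q\le 1$ and every coupling weight function $w$ on $\mathbb{G}\times\mathbb{G}$ that is admissible (for the exponent $q$), the space of matrices $\mathcal{S}_{q,w}(\mathbb{G})$, equipped with $\|\cdot\|_{\mathcal{S}_{q,w}(\mathbb{G})}$, is a proper $q$-Banach subalgebra of $\mathcal{B}(\ell^2(\mathbb{G}))$.
   Context: $\mathbb{G}\subset\mathbb{Z}^d$ ($d\ge 1$) is the discrete spatial domain; $\mathcal{B}(\ell^2(\mathbb{G}))$ is the algebra of bounded operators on $\ell^2(\mathbb{G})$, identified with matrices indexed by $\mathbb{G}\times\mathbb{G}$. Weights. A quasi-distance function is $\rho:\mathbb{G}\times\mathbb{G}\to\mathbb{R}$ with $\rho(i,j)\ge 0$, $\rho(i,j)=0$ iff $i=j$, and $\rho(i,j)=\rho(j,i)$. A coupling weight function is a positive function $w$ on $\mathbb{G}\times\mathbb{G}$ with $w(i,j)\ge 1$, $w(i,j)=w(j,i)$ for all $i,j$, and $\sup_i w(i,i)<\infty$. Given a quasi-distance function $\rho$ and $0<q\le 1$, a coupling weight function $w$ is admissible if there exist a companion weight function $u=[u(i,j)]_{i,j\in\mathbb{G}}$ (itself a coupling weight function), $\theta\in(0,1)$ and $D>0$ such that $w(i,j)\le w(i,k)u(k,j)+u(i,k)w(k,j)$ for all $i,j,k\in\mathbb{G}$, and for all $t\ge 1$ $$\sup_{i\in\mathbb{G}}\inf_{\tau\ge 0}\left\{\Big[\sum_{j\in\mathbb{G},\,\rho(i,j)<\tau}|u(i,j)|^{\frac{2q}{2-q}}\Big]^{1-\frac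 q2}+t\sup_{j\in\mathbb{G},\,\rho(i,j)\ge\tau}\Big(\frac{u(i,j)}{w(i,j)}\Big)^q\right\}\le D\,t^{1-\theta}.$$ Gröchenig–Schur class. $\mathcal{S}_{q,w}(\mathbb{G})$ is the set of matrices $A=[a_{ij}]_{i,j\in\mathbb{G}}$ with $\|A\|_{\mathcal{S}_{q,w}(\mathbb{G})}<\infty$, where $$\|A\|_{\mathcal{S}_{q,w}(\mathbb{G})}=\max\Big\{\sup_{i}\Big(\sum_{j}|a_{ij}|^q w(i,j)^q\Big)^{1/q},\ \sup_{j}\Big(\sum_{i}|a_{ij}|^q w(i,j)^q\Big)^{1/q}\Big\}.$$ Proper $q$-Banach algebras. For $0<q\le 1$, a complex vector space $\mathcal{A}$ of matrices is a $q$-Banach space with $q$-norm $\|\cdot\|_{\mathcal{A}}$ if it is complete with respect to the metric $\|A-B\|_{\mathcal{A}}^q$ and, for all $A,B\in\mathcal{A}$, $\alpha\in\mathbb{C}$: (i) $\|A\|_{\mathcal{A}}\ge 0$, with equality iff $A=0$; (ii) $\|\alpha A\|_{\mathcal{A}}=|\alpha|\,\|A\|_{\mathcal{A}}$; (iii) $\|A+B\|_{\mathcal{A}}^q\le\|A\|_{\mathcal{A}}^q+\|B\|_{\mathcal{A}}^q$. It is a $q$-Banach algebra if it contains the unit $I$ with $\|I\|_{\mathcal{A}}<\infty$ and there is $K_0>0$ with $AB\in\mathcal{A}$, $\|AB\|_{\mathcal{A}}\le K_0\|A\|_{\mathcal{A}}\|B\|_{\mathcal{A}}$ for all $A,B\in\mathcal{A}$.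 It is proper (a proper $q$-Banach subalgebra of $\mathcal{B}=\mathcal{B}(\ell^2(\mathbb{G}))$) if: (P1) $A^*\in\mathcal{A}$ and $\|A^*\|_{\mathcal{A}}=\|A\|_{\mathcal{A}}$ for all $A\in\mathcal{A}$; (P2) $\mathcal{A}$ is a subalgebra of $\mathcal{B}$ and $\|A\|_{\mathcal{B}}\le\|A\|_{\mathcal{A}}$ for all $A\in\mathcal{A}$; (P3) there are $\theta\in(0,1]$ and $D>0$ such that for all $A,B\in\mathcal{A}$ $$\|AB\|_{\mathcal{A}}^q\le D\,\|A\|_{\mathcal{A}}^q\|B\|_{\mathcal{A}}^q\left(\Big(\tfrac{\|A\|_{\mathcal{B}}}{\|A\|_{\mathcal{A}}}\Big)^{q\theta}+\Big(\tfrac{\|B\|_{\mathcal{B}}}{\|B\|_{\mathcal{A}}}\Big)^{q\theta}\right)$$ (right side read as $0$ if $A=0$ or $B=0$). *)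

theory Defs
  imports "HOL-Analysis.Analysis" "HOL-Library.Function_Algebras"
begin

section \<open>Matrices indexed by a set\<close>

text \<open>A matrix indexed by \<open>G \<times> G\<close> is a function that vanishes outside \<open>G \<times> G\<close>, so that equality
  of matrices is equality of functions. Sums and differences are pointwise, from
  \<open>Function_Algebras\<close>; the pointwise product from that theory is not used.\<close>

type_synonym 'i cmat = "'i \<Rightarrow> 'i \<Rightarrow> complex"

definition matrices_on :: "'i set \<Rightarrow> 'i cmat set" where
  "matrices_on G = {A. \<forall>i j. i \<notin> G \<or> j \<notin> G \<longrightarrow> A i j = 0}"

definition mat_id :: "'i set \<Rightarrow> 'i cmat" where
  "mat_id G = (\<lambda>i j. if i \<in> G \<and> i = j then 1 else 0)"

definition mat_smult :: "complex \<Rightarrow> 'i cmat \<Rightarrow> 'i cmat" where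
  "mat_smult c A = (\<lambda>i j. c * A i j)"

definition mat_adj :: "'i cmat \<Rightarrow> 'i cmat" where
  "mat_adj A = (\<lambda>i j. cnj (A j i))"

text \<open>The entries of \<open>mat_mult G A B\<close> are meaningful only where the series converges;
  \<open>mat_mult_defined\<close> records this.\<close>

definition mat_mult :: "'i set \<Rightarrow> 'i cmat \<Rightarrow> 'i cmat \<Rightarrow> 'i cmat" where
  "mat_mult G A B = (\<lambda>i j. \<Sum>\<^sub>\<infinity>k\<in>G. A i k * B k j)"

definition mat_mult_defined :: "'i set \<Rightarrow> 'i cmat \<Rightarrow> 'i cmat \<Rightarrow> bool" where
  "mat_mult_defined G A B \<longleftrightarrow> (\<forall>i\<in>G. \<forall>j\<in>G. (\<lambda>k. A i k * B k j) summable_on G)"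


section \<open>Bounded operators on \<open>\<ell>\<^sup>2\<close>\<close>

definition ell2 :: "'i set \<Rightarrow> ('i \<Rightarrow> complex) set" where
  "ell2 G = {x. (\<forall>i. i \<notin> G \<longrightarrow> x i = 0) \<and> (\<lambda>i. (cmod (x i))\<^sup>2) summable_on G}"

definition ell2_norm :: "'i set \<Rightarrow> ('i \<Rightarrow> complex) \<Rightarrow> real" where
  "ell2_norm G x = sqrt (\<Sum>\<^sub>\<infinity>i\<in>G. (cmod (x i))\<^sup>2)"

definition mat_vec :: "'i set \<Rightarrow> 'i cmat \<Rightarrow> ('i \<Rightarrow> complex) \<Rightarrow> ('i \<Rightarrow> complex)" where
  "mat_vec G A x = (\<lambda>i. \<Sum>\<^sub>\<infinity>j\<in>G. A i j * x j)"

text \<open>The bounded operators on \<open>\<ell>\<^sup>2(G)\<close>, identified with their matrices with respect to the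
  standard basis.\<close>

definition bounded_ops :: "'i set \<Rightarrow> 'i cmat set" where
  "bounded_ops G = {A \<in> matrices_on G.
     (\<forall>x\<in>ell2 G. (\<forall>i\<in>G. (\<lambda>j. A i j * x j) summable_on G) \<and> mat_vec G A x \<in> ell2 G) \<and>
     (\<exists>C. \<forall>x\<in>ell2 G. ell2_norm G (mat_vec G A x) \<le> C * ell2_norm G x)}"

definition op_norm :: "'i set \<Rightarrow> 'i cmat \<Rightarrow> real" where
  "op_norm G A = (SUP x\<in>{x \<in> ell2 G. ell2_norm G x \<le> 1}. ell2_norm G (mat_vec G A x))"


section \<open>Proper \<open>q\<close>-Banach algebras of matrices\<close>

definition q_banach_space :: "'i set \<Rightarrow> real \<Rightarrow> 'i cmat set \<Rightarrow> ('i cmat \<Rightarrow> real) \<Rightarrow> bool" where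
  "q_banach_space G q \<A> N \<longleftrightarrow>
     0 < q \<and> q \<le> 1 \<and>
     \<A> \<subseteq> matrices_on G \<and>
     0 \<in> \<A> \<and>
     (\<forall>A\<in>\<A>. \<forall>B\<in>\<A>. A + B \<in> \<A>) \<and>
     (\<forall>A\<in>\<A>. \<forall>c. mat_smult c A \<in> \<A>) \<and>
     (\<forall>A\<in>\<A>. 0 \<le> N A \<and> (N A = 0 \<longleftrightarrow> A = 0)) \<and>
     (\<forall>A\<in>\<A>. \<forall>c. N (mat_smult c A) = cmod c * N A) \<and>
     (\<forall>A\<in>\<A>. \<forall>B\<in>\<A>. N (A + B) powr q \<le> N A powr q + N B powr q) \<and>
     Metric_space.mcomplete \<A> (\<lambda>A B. N (A - B) powr q)"

definition q_banach_algebra :: "'i set \<Rightarrow> real \<Rightarrow> 'i cmat set \<Rightarrow> ('i cmat \<Rightarrow> real) \<Rightarrow> bool" where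
  "q_banach_algebra G q \<A> N \<longleftrightarrow>
     q_banach_space G q \<A> N \<and>
     mat_id G \<in> \<A> \<and>
     (\<exists>K>0. \<forall>A\<in>\<A>. \<forall>B\<in>\<A>.
        mat_mult_defined G A B \<and> mat_mult G A B \<in> \<A> \<and> N (mat_mult G A B) \<le> K * N A * N B)"

text \<open>In the last condition, \<open>0 powr q = 0\<close> makes the right-hand side \<open>0\<close> when
  \<open>A = 0\<close> or \<open>B = 0\<close>, as it should be.\<close>

definition proper_q_banach_subalgebra ::
    "'i set \<Rightarrow> real \<Rightarrow> 'i cmat set \<Rightarrow> ('i cmat \<Rightarrow> real) \<Rightarrow> bool" where
  "proper_q_banach_subalgebra G q \<A> N \<longleftrightarrow>
     q_banach_algebra G q \<A> N \<and>
     (\<forall>A\<in>\<A>. mat_adj A \<in> \<A> \<and> N (mat_adj A) = N A) \<and>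
     \<A> \<subseteq> bounded_ops G \<and>
     (\<forall>A\<in>\<A>. op_norm G A \<le> N A) \<and>
     (\<exists>\<theta> D. 0 < \<theta> \<and> \<theta> \<le> 1 \<and> 0 < D \<and>
        (\<forall>A\<in>\<A>. \<forall>B\<in>\<A>.
           N (mat_mult G A B) powr q \<le>
             D * N A powr q * N B powr q *
             ((op_norm G A / N A) powr (q * \<theta>) + (op_norm G B / N B) powr (q * \<theta>))))"


section \<open>Weights\<close>

definition quasi_distance :: "'i set \<Rightarrow> ('i \<Rightarrow> 'i \<Rightarrow> real) \<Rightarrow> bool" where
  "quasi_distance G \<rho> \<longleftrightarrow>
     (\<forall>i\<in>G. \<forall>j\<in>G. 0 \<le> \<rho> i j \<and> (\<rho> i j = 0 \<longleftrightarrow> i = j) \<and> \<rho> i j = \<rho> j i)"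

definition coupling_weight :: "'i set \<Rightarrow> ('i \<Rightarrow> 'i \<Rightarrow> real) \<Rightarrow> bool" where
  "coupling_weight G w \<longleftrightarrow>
     (\<forall>i\<in>G. \<forall>j\<in>G. 1 \<le> w i j \<and> w i j = w j i) \<and> bdd_above ((\<lambda>i. w i i) ` G)"

text \<open>The power \<open>x\<^sup>p\<close> of an extended nonnegative real, for \<open>p > 0\<close>.\<close>

definition ennreal_powr :: "ennreal \<Rightarrow> real \<Rightarrow> ennreal" where
  "ennreal_powr x p = (if x = \<infinity> then \<infinity> else ennreal (enn2real x powr p))"

text \<open>Sums, suprema and infima are taken in \<^typ>\<open>ennreal\<close>: they always exist, divergent sums and
  unbounded suprema are \<open>\<infinity>\<close>, and the supremum of the empty set is \<open>0\<close>.\<close>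

definition admissible_weight ::
    "'i set \<Rightarrow> ('i \<Rightarrow> 'i \<Rightarrow> real) \<Rightarrow> real \<Rightarrow> ('i \<Rightarrow> 'i \<Rightarrow> real) \<Rightarrow> bool" where
  "admissible_weight G \<rho> q w \<longleftrightarrow>
     (\<exists>u \<theta> D. coupling_weight G u \<and> 0 < \<theta> \<and> \<theta> < 1 \<and> 0 < D \<and>
        (\<forall>i\<in>G. \<forall>j\<in>G. \<forall>k\<in>G. w i j \<le> w i k * u k j + u i k * w k j) \<and>
        (\<forall>t\<ge>1.
           (SUP i\<in>G. INF \<tau>\<in>{0..}.
              ennreal_powr (\<Sum>\<^sub>\<infinity>j\<in>{j\<in>G. \<rho> i j < \<tau>}. ennreal (\<bar>u i j\<bar> powr (2 * q / (2 - q))))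
                (1 - q / 2)
              + ennreal t * (SUP j\<in>{j\<in>G. \<tau> \<le> \<rho> i j}. ennreal ((u i j / w i j) powr q)))
           \<le> ennreal (D * t powr (1 - \<theta>))))"


section \<open>The Groechenig--Schur class\<close>

definition gs_ennnorm :: "'i set \<Rightarrow> real \<Rightarrow> ('i \<Rightarrow> 'i \<Rightarrow> real) \<Rightarrow> 'i cmat \<Rightarrow> ennreal" where
  "gs_ennnorm G q w A =
     max
       (SUP i\<in>G. ennreal_powr (\<Sum>\<^sub>\<infinity>j\<in>G. ennreal (cmod (A i j) powr q * w i j powr q)) (1 / q))
       (SUP j\<in>G. ennreal_powr (\<Sum>\<^sub>\<infinity>i\<in>G. ennreal (cmod (A i j) powr q * w i j powr q)) (1 / q))"

definition gs_class :: "'i set \<Rightarrow> real \<Rightarrow> ('i \<Rightarrow> 'i \<Rightarrow> real) \<Rightarrow> 'i cmat set" where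
  "gs_class G q w = {A \<in> matrices_on G. gs_ennnorm G q w A < \<infinity>}"

definition gs_norm :: "'i set \<Rightarrow> real \<Rightarrow> ('i \<Rightarrow> 'i \<Rightarrow> real) \<Rightarrow> 'i cmat \<Rightarrow> real" where
  "gs_norm G q w A = enn2real (gs_ennnorm G q w A)"

end

(* The quantity driving the estimate is the l^q sum of a row or column of A against the companion
   weight u. Near the diagonal it is controlled, by Hoelder's inequality with exponents 2/q and 2/(2-q),
   by the l^2 norm of the row, which is at most the operator norm of A; away from the diagonal it is
   controlled by the w-weighted sum times sup (u/w)^q. Admissibility with t = (||A||_S / ||A||_B)^q
   balances the two parts and gives the bound D ||A||_S^q (||A||_B / ||A||_S)^(q theta). Inserting
   w(i,j) <= w(i,k) u(k,j) + u(i,k) w(k,j) in the sums of AB then yields (P3), and hence also the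
   algebra property, because ||A||_B <= ||A||_S by the Schur test and the inclusion of l^q in l^1. *)
theory Submission
  imports Defs
begin

section \<open>Sums with bounded finite partial sums\<close>

text \<open>For \<open>q < 1\<close> the triangle inequality fails, so all estimates concern
  \<open>q\<close>-th powers: \<open>x powr q\<close> is subadditive and can be moved inside every
  sum over an intermediate index. Since \<open>infsum\<close> has the default value 0 on families
  that are not summable, inequalities are proved for finite truncations with a bound independent of
  the truncation, and limits are taken only afterwards. The same device yields the lower
  semicontinuity of the norm on which completeness rests. Write \<open>s\<close> for the operator
  norm and \<open>n\<close> for the Schur norm. The Schur test gives \<open>s \<le> n\<close>, which
  makes \<open>t \<ge> 1\<close>. Then \<open>s powr q * t = n powr q\<close>, so both parts of the
  split carry the factor \<open>s powr q\<close>, and \<open>s powr q * t powr (1 - \<theta>) = n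
  powr q * (s / n) powr (q * \<theta>)\<close>. Hence (P3) inherits \<theta> and \<open>D\<close>
  from admissibility unchanged. Columns of a product are rows of the transposed product with the
  factors exchanged; the main estimates are therefore stated for a single row with weights of its
  own.\<close>

text \<open>Bounding all finite partial sums, rather than an infinite sum, needs no summability and is
  preserved by pointwise limits.\<close>

definition sum_le :: "'i set \<Rightarrow> ('i \<Rightarrow> real) \<Rightarrow> real \<Rightarrow> bool" where
  "sum_le G f c \<longleftrightarrow> (\<forall>F. finite F \<and> F \<subseteq> G \<longrightarrow> sum f F \<le> c)"

lemma sum_leI: "(\<And>F. finite F \<Longrightarrow> F \<subseteq> G \<Longrightarrow> sum f F \<le> c) \<Longrightarrow> sum_le G f c"
  by (auto simp: sum_le_def)

lemma sum_leD: "sum_le G f c \<Longrightarrow> finite F \<Longrightarrow> F \<subseteq> G \<Longrightarrow> sum f F \<le> c"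
  by (auto simp: sum_le_def)

lemma sum_le_point: "sum_le G f c \<Longrightarrow> i \<in> G \<Longrightarrow> f i \<le> c"
  using sum_leD[of G f c "{i}"] by simp

lemma sum_le_mono: "sum_le G f c \<Longrightarrow> c \<le> d \<Longrightarrow> sum_le G f d"
  unfolding sum_le_def by (meson order.trans)

lemma sum_le_cong: "(\<And>i. i \<in> G \<Longrightarrow> f i = g i) \<Longrightarrow> sum_le G f c \<longleftrightarrow> sum_le G g c"
  unfolding sum_le_def by (metis subset_iff sum.cong)

lemma sum_le_summable:
  assumes "sum_le G f c" "\<And>i. i \<in> G \<Longrightarrow> 0 \<le> f i"
  shows "f summable_on G"
  by (rule nonneg_bdd_above_summable_on)
     (use assms in \<open>auto simp: bdd_above_def sum_le_def\<close>)

lemma sum_le_infsum_iff: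
  assumes "f summable_on G" "\<And>i. i \<in> G \<Longrightarrow> 0 \<le> f i"
  shows "sum_le G f c \<longleftrightarrow> infsum f G \<le> c"
proof
  assume "sum_le G f c"
  then show "infsum f G \<le> c"
    using assms by (intro infsum_le_finite_sums) (auto simp: sum_le_def)
next
  assume "infsum f G \<le> c"
  then show "sum_le G f c"
    using finite_sum_le_infsum[OF assms(1)] assms(2) by (force simp: sum_le_def)
qed

text \<open>An infinite sum in \<open>ennreal\<close> is the supremum of its finite partial sums, so
  the equivalence covers the divergent case too: both sides then fail.\<close>

lemma sum_le_ennreal_iff:
  assumes "\<And>i. i \<in> G \<Longrightarrow> 0 \<le> f i" "0 \<le> c"
  shows "(\<Sum>\<^sub>\<infinity>i\<in>G. ennreal (f i)) \<le> ennreal c \<longleftrightarrow> sum_le G f c"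
proof -
  have "(\<Sum>\<^sub>\<infinity>i\<in>G. ennreal (f i)) = (SUP F\<in>{F. finite F \<and> F \<subseteq> G}. \<Sum>i\<in>F. ennreal (f i))"
    by (rule nonneg_infsum_complete) auto
  moreover have "(\<Sum>i\<in>F. ennreal (f i)) = ennreal (sum f F)" if "F \<subseteq> G" for F
    using that assms(1) by (intro sum_ennreal) auto
  ultimately show ?thesis
    using assms by (auto simp: SUP_le_iff sum_le_def ennreal_le_iff)
qed

text \<open>The \<open>p\<close>-th power is monotone with inverse the power \<open>1 / p\<close>;
  at infinity both sides are false. It serves for the exponent \<open>1 / q\<close> of the norm and
  for \<open>1 - q / 2\<close> in admissibility.\<close>

lemma ennreal_powr_le_iff:
  assumes "0 < p" "0 \<le> c"
  shows "ennreal_powr x p \<le> ennreal c \<longleftrightarrow> x \<le> ennreal (c powr (1 / p))"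
proof (cases x)
  case (real r)
  have "r powr p \<le> c \<longleftrightarrow> r \<le> c powr (1 / p)"
  proof
    assume "r powr p \<le> c"
    then have "(r powr p) powr (1 / p) \<le> c powr (1 / p)"
      using assms by (intro powr_mono2) auto
    then show "r \<le> c powr (1 / p)" using assms real by (simp add: powr_powr)
  next
    assume "r \<le> c powr (1 / p)"
    then have "r powr p \<le> (c powr (1 / p)) powr p"
      using assms real by (intro powr_mono2) auto
    then show "r powr p \<le> c" using assms by (simp add: powr_powr)
  qed
  then show ?thesis using real assms by (simp add: ennreal_powr_def ennreal_le_iff)
next
  case top
  then show ?thesis by (simp add: ennreal_powr_def top_unique)
qed

section \<open>Power inequalities\<close>

text \<open>Division by \<open>a + b\<close> reduces the claim to two numbers in the unit interval
  with sum 1, and there \<open>x \<le> x powr q\<close> because \<open>q \<le> 1\<close>.\<close>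

lemma add_powr_le:
  fixes a b q :: real
  assumes "0 \<le> a" "0 \<le> b" "0 < q" "q \<le> 1"
  shows "(a + b) powr q \<le> a powr q + b powr q"
proof (cases "a + b = 0")
  case False
  then have s: "a + b > 0" using assms by linarith
  have *: "x / (a + b) \<le> (x / (a + b)) powr q" if "0 \<le> x" "x \<le> a + b" for x
    using powr_mono'[of q 1 "x / (a + b)"] that s assms by simp
  have "1 = a / (a + b) + b / (a + b)" using s by (simp flip: add_divide_distrib)
  also have "\<dots> \<le> (a / (a + b)) powr q + (b / (a + b)) powr q"
    using *[of a] *[of b] assms by linarith
  also have "\<dots> = (a powr q + b powr q) / (a + b) powr q"
    using assms s by (simp add: powr_divide add_divide_distrib)
  finally show ?thesis using s by (simp add: field_simps)
qed (use assms in simp)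

lemma sum_powr_le:
  fixes f :: "'a \<Rightarrow> real"
  assumes "\<And>i. i \<in> F \<Longrightarrow> 0 \<le> f i" "0 < q" "q \<le> 1"
  shows "sum f F powr q \<le> (\<Sum>i\<in>F. f i powr q)"
  using assms(1)
proof (induction F rule: infinite_finite_induct)
  case (insert x F)
  have "(f x + sum f F) powr q \<le> f x powr q + sum f F powr q"
    using insert assms by (intro add_powr_le sum_nonneg) auto
  also have "\<dots> \<le> f x powr q + (\<Sum>i\<in>F. f i powr q)" using insert by simp
  finally show ?case using insert by simp
qed auto

text \<open>Once both families are normalised, Young's inequality applied to each term adds up to
  \<open>1 / p + 1 / r = 1\<close>.\<close>

lemma Hoelder_inequality_sum:
  fixes f g :: "'a \<Rightarrow> real"
  assumes pr: "p > 1" "r > 1" "1 / p + 1 / r = 1"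
    and f: "\<And>i. i \<in> F \<Longrightarrow> 0 \<le> f i" and g: "\<And>i. i \<in> F \<Longrightarrow> 0 \<le> g i"
  shows "(\<Sum>i\<in>F. f i * g i) \<le> (\<Sum>i\<in>F. f i powr p) powr (1 / p) * (\<Sum>i\<in>F. g i powr r) powr (1 / r)"
proof (cases "finite F \<and> (\<Sum>i\<in>F. f i powr p) \<noteq> 0 \<and> (\<Sum>i\<in>F. g i powr r) \<noteq> 0")
  case True
  define X where "X = (\<Sum>i\<in>F. f i powr p)"
  define Y where "Y = (\<Sum>i\<in>F. g i powr r)"
  have X: "X > 0" and Y: "Y > 0"
    using True sum_nonneg[of F "\<lambda>i. f i powr p"] sum_nonneg[of F "\<lambda>i. g i powr r"]
    by (auto simp: X_def Y_def less_le)
  have "(\<Sum>i\<in>F. (f i / X powr (1 / p)) * (g i / Y powr (1 / r)))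
      \<le> (\<Sum>i\<in>F. (f i powr p / X) / p + (g i powr r / Y) / r)"
  proof (rule sum_mono)
    fix i assume i: "i \<in> F"
    have "(f i / X powr (1 / p)) * (g i / Y powr (1 / r))
        \<le> (f i / X powr (1 / p)) powr p / p + (g i / Y powr (1 / r)) powr r / r"
      using i pr f g by (intro Youngs_inequality) auto
    then show "(f i / X powr (1 / p)) * (g i / Y powr (1 / r)) \<le> (f i powr p / X) / p + (g i powr r / Y) / r"
      using i pr X Y f g by (simp add: powr_divide powr_powr)
  qed
  also have "\<dots> = 1"
    using X Y pr by (simp add: sum.distrib X_def[symmetric] Y_def[symmetric] flip: sum_divide_distrib)
  finally have "(\<Sum>i\<in>F. f i * g i) / (X powr (1 / p) * Y powr (1 / r)) \<le> 1"
    by (simp add: sum_divide_distrib)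
  then show ?thesis using X Y unfolding X_def[symmetric] Y_def[symmetric] by (simp add: field_simps)
next
  case False
  \<comment> \<open>A vanishing power sum forces all its terms, hence all products, to vanish; for
    infinite \<open>F\<close> the left-hand sum is 0 by convention.\<close>
  have "f i * g i = 0" if "finite F" "i \<in> F" for i
    using False that by (auto simp: sum_nonneg_eq_0_iff)
  then have "(\<Sum>i\<in>F. f i * g i) = 0"
    by (cases "finite F") (auto intro: sum.neutral)
  then show ?thesis by simp
qed

section \<open>The Groechenig--Schur norm through partial sums\<close>

text \<open>The bound \<open>c\<close> is one for the \<open>q\<close>-th power of the norm.\<close>

definition schur_le :: "'i set \<Rightarrow> real \<Rightarrow> ('i \<Rightarrow> 'i \<Rightarrow> real) \<Rightarrow> 'i cmat \<Rightarrow> real \<Rightarrow> bool" where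
  "schur_le G q w A c \<longleftrightarrow> 0 \<le> c \<and>
     (\<forall>i\<in>G. sum_le G (\<lambda>j. (cmod (A i j) * w i j) powr q) c \<and>
            sum_le G (\<lambda>j. (cmod (A j i) * w j i) powr q) c)"

text \<open>In a comparison with a constant the suprema and the outer power \<open>1 / q\<close>
  dissolve, which turns membership and norm bounds into statements about finite real sums.\<close>

lemma gs_ennnorm_le_iff:
  assumes "0 < q" "0 \<le> c" and w: "\<And>i j. i \<in> G \<Longrightarrow> j \<in> G \<Longrightarrow> 0 \<le> w i j"
  shows "gs_ennnorm G q w A \<le> ennreal c \<longleftrightarrow> schur_le G q w A (c powr q)"
proof -
  have 1: "ennreal_powr (\<Sum>\<^sub>\<infinity>j\<in>G. ennreal (cmod (A i j) powr q * w i j powr q)) (1 / q) \<le> ennreal c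
      \<longleftrightarrow> sum_le G (\<lambda>j. (cmod (A i j) * w i j) powr q) (c powr q)" if "i \<in> G" for i
    using assms that
    by (simp add: ennreal_powr_le_iff sum_le_ennreal_iff powr_mult cong: sum_le_cong)
  have 2: "ennreal_powr (\<Sum>\<^sub>\<infinity>j\<in>G. ennreal (cmod (A j i) powr q * w j i powr q)) (1 / q) \<le> ennreal c
      \<longleftrightarrow> sum_le G (\<lambda>j. (cmod (A j i) * w j i) powr q) (c powr q)" if "i \<in> G" for i
    using assms that
    by (simp add: ennreal_powr_le_iff sum_le_ennreal_iff powr_mult cong: sum_le_cong)
  show ?thesis
    unfolding gs_ennnorm_def schur_le_def by (auto simp: SUP_le_iff 1 2)
qed

lemma gs_norm_nonneg: "0 \<le> gs_norm G q w A"
  by (simp add: gs_norm_def)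

lemma gs_class_schur_le:
  assumes "0 < q" "\<And>i j. i \<in> G \<Longrightarrow> j \<in> G \<Longrightarrow> 0 \<le> w i j" "A \<in> gs_class G q w"
  shows "schur_le G q w A (gs_norm G q w A powr q)"
proof -
  have "gs_ennnorm G q w A = ennreal (gs_norm G q w A)"
    using assms(3) by (auto simp: gs_class_def gs_norm_def)
  then show ?thesis using gs_ennnorm_le_iff[of q "gs_norm G q w A" G w A] assms
    by (simp add: gs_norm_nonneg)
qed

lemma schur_le_gs_class:
  assumes "0 < q" "\<And>i j. i \<in> G \<Longrightarrow> j \<in> G \<Longrightarrow> 0 \<le> w i j"
    and "A \<in> matrices_on G" "schur_le G q w A c"
  shows "A \<in> gs_class G q w" "gs_norm G q w A powr q \<le> c"
proof -
  have c: "0 \<le> c" using assms(4) by (simp add: schur_le_def)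
  have le: "gs_ennnorm G q w A \<le> ennreal (c powr (1 / q))"
    using assms c by (subst gs_ennnorm_le_iff) (auto simp: powr_powr)
  then show "A \<in> gs_class G q w"
    using assms(3) by (auto simp: gs_class_def intro: le_less_trans)
  have "gs_norm G q w A \<le> c powr (1 / q)"
    unfolding gs_norm_def using enn2real_mono[OF le] by simp
  then have "gs_norm G q w A powr q \<le> (c powr (1 / q)) powr q"
    using assms(1) by (intro powr_mono2) (auto simp: gs_norm_nonneg)
  then show "gs_norm G q w A powr q \<le> c" using assms(1) c by (simp add: powr_powr)
qed

section \<open>The operator norm\<close>

lemma ell2_sum_le: "x \<in> ell2 G \<Longrightarrow> sum_le G (\<lambda>i. (cmod (x i))\<^sup>2) ((ell2_norm G x)\<^sup>2)"
  by (subst sum_le_infsum_iff) (auto simp: ell2_def ell2_norm_def infsum_nonneg)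

lemma sum_le_ell2:
  assumes "\<And>i. i \<notin> G \<Longrightarrow> x i = 0" "sum_le G (\<lambda>i. (cmod (x i))\<^sup>2) c"
  shows "x \<in> ell2 G" "(ell2_norm G x)\<^sup>2 \<le> c"
proof -
  have s: "(\<lambda>i. (cmod (x i))\<^sup>2) summable_on G" using sum_le_summable[OF assms(2)] by simp
  then show "x \<in> ell2 G" using assms(1) by (auto simp: ell2_def)
  have "(ell2_norm G x)\<^sup>2 = (\<Sum>\<^sub>\<infinity>i\<in>G. (cmod (x i))\<^sup>2)"
    by (simp add: ell2_norm_def infsum_nonneg)
  then show "(ell2_norm G x)\<^sup>2 \<le> c" using assms(2) sum_le_infsum_iff[OF s] by simp
qed

lemma ell2_norm_nonneg [simp]: "0 \<le> ell2_norm G x"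
  by (simp add: ell2_norm_def infsum_nonneg)

lemma ell2_norm_scale: "ell2_norm G (\<lambda>i. c * x i) = cmod c * ell2_norm G x"
  by (simp add: ell2_norm_def norm_mult power_mult_distrib infsum_cmult_right' real_sqrt_mult)

lemma ell2_scale: "x \<in> ell2 G \<Longrightarrow> (\<lambda>i. c * x i) \<in> ell2 G"
  by (auto simp: ell2_def norm_mult power_mult_distrib summable_on_cmult_right)

lemma mat_vec_scale: "mat_vec G A (\<lambda>i. c * x i) = (\<lambda>i. c * mat_vec G A x i)"
  by (simp add: mat_vec_def mult.left_commute infsum_cmult_right')

lemma op_norm_bdd_above:
  assumes "A \<in> bounded_ops G"
  shows "bdd_above ((\<lambda>x. ell2_norm G (mat_vec G A x)) ` {x \<in> ell2 G. ell2_norm G x \<le> 1})"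
proof -
  obtain C where C: "\<forall>x\<in>ell2 G. ell2_norm G (mat_vec G A x) \<le> C * ell2_norm G x"
    using assms by (auto simp: bounded_ops_def)
  \<comment> \<open>The constant in \<open>bounded_ops\<close> carries no sign, hence the absolute
    value.\<close>
  have "C * ell2_norm G x \<le> \<bar>C\<bar>" if "ell2_norm G x \<le> 1" for x
  proof -
    have "C * ell2_norm G x \<le> \<bar>C\<bar> * ell2_norm G x" by (intro mult_right_mono) auto
    also have "\<dots> \<le> \<bar>C\<bar> * 1" using that by (intro mult_left_mono) auto
    finally show ?thesis by simp
  qed
  then show ?thesis using C by (intro bdd_aboveI[of _ "\<bar>C\<bar>"]) (force intro: order_trans)
qed

text \<open>Homogeneity reduces to the unit ball, where the supremum applies. A vector of norm 0
  cannot be rescaled, but there the constant from \<open>bounded_ops\<close> already forces the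
  image to have norm 0.\<close>

lemma ell2_norm_mat_vec_le:
  assumes A: "A \<in> bounded_ops G" and x: "x \<in> ell2 G"
  shows "ell2_norm G (mat_vec G A x) \<le> op_norm G A * ell2_norm G x"
proof (cases "ell2_norm G x = 0")
  case True
  then show ?thesis using A x by (auto simp: bounded_ops_def)
next
  case False
  define r where "r = ell2_norm G x"
  have r: "r > 0" using False by (simp add: r_def less_le)
  define y where "y = (\<lambda>i. complex_of_real (1 / r) * x i)"
  have "ell2_norm G y \<le> 1" "y \<in> ell2 G"
    unfolding y_def using r ell2_scale[OF x] by (auto simp only: ell2_norm_scale) (simp add: norm_divide flip: r_def)
  then have "ell2_norm G (mat_vec G A y) \<le> op_norm G A"
    unfolding op_norm_def by (intro cSUP_upper op_norm_bdd_above A) auto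
  moreover have "ell2_norm G (mat_vec G A y) = ell2_norm G (mat_vec G A x) / r"
    unfolding y_def mat_vec_scale ell2_norm_scale using r by (simp add: norm_divide)
  ultimately show ?thesis using r by (simp add: field_simps flip: r_def)
qed

lemma op_norm_le:
  assumes "0 \<le> c" "\<And>x. x \<in> ell2 G \<Longrightarrow> ell2_norm G (mat_vec G A x) \<le> c * ell2_norm G x"
  shows "op_norm G A \<le> c"
  unfolding op_norm_def
proof (rule cSUP_least)
  have "(\<lambda>_. 0) \<in> ell2 G \<and> ell2_norm G (\<lambda>_. 0) \<le> 1" by (simp add: ell2_def ell2_norm_def)
  then show "{x \<in> ell2 G. ell2_norm G x \<le> 1} \<noteq> {}" by blast
  fix x assume "x \<in> {x \<in> ell2 G. ell2_norm G x \<le> 1}"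
  then have "ell2_norm G (mat_vec G A x) \<le> c * ell2_norm G x" "c * ell2_norm G x \<le> c * 1"
    using assms by (blast, intro mult_left_mono) auto
  then show "ell2_norm G (mat_vec G A x) \<le> c" by simp
qed

lemma op_norm_nonneg:
  assumes "A \<in> bounded_ops G"
  shows "0 \<le> op_norm G A"
proof -
  have "ell2_norm G (mat_vec G A (\<lambda>_. 0)) \<le> op_norm G A"
    unfolding op_norm_def 
    by (intro cSUP_upper op_norm_bdd_above assms) (auto simp: ell2_def ell2_norm_def)
  then show ?thesis using ell2_norm_nonneg order_trans by blast
qed

text \<open>Column \<open>k\<close> is the image of the basis vector at \<open>k\<close>, which has
  norm at most 1.\<close>

lemma op_norm_column:
  assumes A: "A \<in> bounded_ops G" and k: "k \<in> G"
  shows "sum_le G (\<lambda>i. (cmod (A i k))\<^sup>2) ((op_norm G A)\<^sup>2)"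
proof -
  define e :: "'a \<Rightarrow> complex" where "e = (\<lambda>j. if j = k then 1 else 0)"
  have "sum_le G (\<lambda>i. (cmod (e i))\<^sup>2) 1"
  proof (rule sum_leI)
    fix F :: "'a set" assume "finite F"
    have "(\<Sum>i\<in>F. (cmod (e i))\<^sup>2) = (\<Sum>i\<in>F. if i = k then 1 else 0)"
      by (intro sum.cong) (auto simp: e_def)
    then show "(\<Sum>i\<in>F. (cmod (e i))\<^sup>2) \<le> 1" using \<open>finite F\<close> by simp
  qed
  then have e: "e \<in> ell2 G" "(ell2_norm G e)\<^sup>2 \<le> 1"
    using k by (intro sum_le_ell2[of G e]; force simp: e_def)+
  have Ae: "mat_vec G A e i = A i k" for i
  proof -
    have "(\<Sum>\<^sub>\<infinity>j\<in>G. A i j * e j) = (\<Sum>\<^sub>\<infinity>j\<in>{k}. A i j * e j)"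
      using k by (intro infsum_cong_neutral) (auto simp: e_def)
    then show ?thesis by (simp add: mat_vec_def e_def)
  qed
  have "mat_vec G A e \<in> ell2 G" using A e by (auto simp: bounded_ops_def)
  then have "sum_le G (\<lambda>i. (cmod (mat_vec G A e i))\<^sup>2) ((ell2_norm G (mat_vec G A e))\<^sup>2)"
    by (rule ell2_sum_le)
  moreover have "(ell2_norm G (mat_vec G A e))\<^sup>2 \<le> (op_norm G A)\<^sup>2"
  proof -
    have "ell2_norm G (mat_vec G A e) \<le> op_norm G A * ell2_norm G e"
      by (rule ell2_norm_mat_vec_le[OF A e(1)])
    also have "\<dots> \<le> op_norm G A * 1"
      using e(2) op_norm_nonneg[OF A] by (intro mult_left_mono) (auto simp: power_le_one_iff abs_square_le_1)
    finally show ?thesis by (simp add: power_mono)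
  qed
  ultimately show ?thesis using sum_le_mono by (auto simp: Ae)
qed

text \<open>A test vector replaces the adjoint operator: the conjugated row, cut off to the finite
  set \<open>F\<close> so that it lies in \<open>ell2 G\<close>. Coordinate \<open>i\<close> of its
  image is the square sum \<open>s\<close> itself, so
  \<open>s * s \<le> (op_norm G A)\<^sup>2 * s\<close>, and \<open>s\<close> cancels unless it is
  0.\<close>

lemma op_norm_row:
  assumes A: "A \<in> bounded_ops G" and i: "i \<in> G"
  shows "sum_le G (\<lambda>k. (cmod (A i k))\<^sup>2) ((op_norm G A)\<^sup>2)"
proof (rule sum_leI)
  fix F assume F: "finite F" "F \<subseteq> G"
  define s where "s = (\<Sum>k\<in>F. (cmod (A i k))\<^sup>2)"
  have s: "0 \<le> s" by (auto simp: s_def intro: sum_nonneg)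
  define x where "x = (\<lambda>k. if k \<in> F then cnj (A i k) else 0)"
  have "sum_le G (\<lambda>i. (cmod (x i))\<^sup>2) s"
  proof (rule sum_leI)
    fix H :: "'a set" assume "finite H"
    have "(\<Sum>k\<in>H. (cmod (x k))\<^sup>2) = (\<Sum>k\<in>H \<inter> F. (cmod (A i k))\<^sup>2)"
      using \<open>finite H\<close> by (intro sum.mono_neutral_cong_right) (auto simp: x_def)
    also have "\<dots> \<le> s" unfolding s_def using F by (intro sum_mono2) auto
    finally show "(\<Sum>k\<in>H. (cmod (x k))\<^sup>2) \<le> s" .
  qed
  then have x: "x \<in> ell2 G" "(ell2_norm G x)\<^sup>2 \<le> s"
    using F by (intro sum_le_ell2[of G x]; force simp: x_def)+
  have Ax: "mat_vec G A x i = of_real s"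
  proof -
    have "(\<Sum>\<^sub>\<infinity>j\<in>G. A i j * x j) = (\<Sum>\<^sub>\<infinity>j\<in>F. A i j * x j)"
      using F by (intro infsum_cong_neutral) (auto simp: x_def)
    also have "\<dots> = (\<Sum>k\<in>F. of_real ((cmod (A i k))\<^sup>2))"
      using F by (simp add: x_def complex_norm_square del: of_real_power)
    finally show ?thesis by (simp add: mat_vec_def s_def)
  qed
  have "mat_vec G A x \<in> ell2 G" using A x by (auto simp: bounded_ops_def)
  from sum_le_point[OF ell2_sum_le[OF this] i]
  have "s\<^sup>2 \<le> (ell2_norm G (mat_vec G A x))\<^sup>2" using s by (simp add: Ax)
  also have "\<dots> \<le> (op_norm G A * ell2_norm G x)\<^sup>2"
    by (intro power_mono ell2_norm_mat_vec_le A x) auto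
  also have "\<dots> \<le> (op_norm G A)\<^sup>2 * s"
    using x(2) by (simp add: power_mult_distrib mult_left_mono)
  finally have "s * s \<le> (op_norm G A)\<^sup>2 * s" by (simp add: power2_eq_square)
  then show "(\<Sum>k\<in>F. (cmod (A i k))\<^sup>2) \<le> (op_norm G A)\<^sup>2"
    using s unfolding s_def[symmetric] by (cases "s = 0") auto
qed

text \<open>Cauchy-Schwarz uses the row sums once, and exchanging the order of summation uses the
  column sums once; each contributes a factor \<open>n\<close> to the squared norm.\<close>

lemma Schur_test_vector:
  assumes n: "0 \<le> n" and A: "A \<in> matrices_on G"
    and row: "\<And>i. i \<in> G \<Longrightarrow> sum_le G (\<lambda>j. cmod (A i j)) n"
    and col: "\<And>j. j \<in> G \<Longrightarrow> sum_le G (\<lambda>i. cmod (A i j)) n"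
    and x: "x \<in> ell2 G"
  shows "\<forall>i\<in>G. (\<lambda>j. A i j * x j) summable_on G"
    and "mat_vec G A x \<in> ell2 G"
    and "ell2_norm G (mat_vec G A x) \<le> n * ell2_norm G x"
proof -
  let ?r = "ell2_norm G x"
  have xj: "cmod (x j) \<le> ?r" if "j \<in> G" for j
    using sum_le_point[OF ell2_sum_le[OF x] that] by (simp add: power2_le_iff_abs_le)
  show summ: "\<forall>i\<in>G. (\<lambda>j. A i j * x j) summable_on G"
  proof
    fix i assume i: "i \<in> G"
    have "(\<lambda>j. cmod (A i j) * ?r) summable_on G"
      by (intro summable_on_cmult_left sum_le_summable[OF row[OF i]]) auto
    then have "(\<lambda>j. norm (A i j * x j)) summable_on G"
      by (rule summable_on_comparison_test)
         (auto simp: norm_mult intro!: mult_left_mono xj)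
    then show "(\<lambda>j. A i j * x j) summable_on G" by (rule abs_summable_summable)
  qed
  have "sum_le G (\<lambda>i. (cmod (mat_vec G A x i))\<^sup>2) ((n * ?r)\<^sup>2)"
  proof (rule sum_leI)
    fix F assume F: "finite F" "F \<subseteq> G"
    have fin: "(\<Sum>i\<in>F. (cmod (\<Sum>j\<in>H. A i j * x j))\<^sup>2) \<le> (n * ?r)\<^sup>2"
      if H: "finite H" "H \<subseteq> G" for H
    proof -
      have "(cmod (\<Sum>j\<in>H. A i j * x j))\<^sup>2 \<le> n * (\<Sum>j\<in>H. cmod (A i j) * (cmod (x j))\<^sup>2)" if "i \<in> F" for i
      proof -
        \<comment> \<open>Each entry is split into two square roots, so that one factor of
          Cauchy-Schwarz is a plain row sum and the other keeps one power of the entry for the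
          column sums.\<close>
        have "(cmod (\<Sum>j\<in>H. A i j * x j))\<^sup>2 \<le> (\<Sum>j\<in>H. sqrt (cmod (A i j)) * (sqrt (cmod (A i j)) * cmod (x j)))\<^sup>2"
          by (intro power_mono order.trans[OF norm_sum]) (auto simp: norm_mult simp flip: mult.assoc)
        also have "\<dots> \<le> (\<Sum>j\<in>H. (sqrt (cmod (A i j)))\<^sup>2) * (\<Sum>j\<in>H. (sqrt (cmod (A i j)) * cmod (x j))\<^sup>2)"
          by (rule Cauchy_Schwarz_ineq_sum)
        also have "\<dots> = (\<Sum>j\<in>H. cmod (A i j)) * (\<Sum>j\<in>H. cmod (A i j) * (cmod (x j))\<^sup>2)"
          by (simp add: power_mult_distrib)
        also have "\<dots> \<le> n * (\<Sum>j\<in>H. cmod (A i j) * (cmod (x j))\<^sup>2)"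
          using sum_leD[OF row H] that F by (intro mult_right_mono sum_nonneg) auto
        finally show ?thesis .
      qed
      then have "(\<Sum>i\<in>F. (cmod (\<Sum>j\<in>H. A i j * x j))\<^sup>2)
          \<le> (\<Sum>i\<in>F. n * (\<Sum>j\<in>H. cmod (A i j) * (cmod (x j))\<^sup>2))" by (rule sum_mono)
      also have "\<dots> = n * (\<Sum>j\<in>H. (\<Sum>i\<in>F. cmod (A i j)) * (cmod (x j))\<^sup>2)"
        by (simp add: sum_distrib_right sum.swap[of _ F] flip: sum_distrib_left)
      also have "\<dots> \<le> n * (\<Sum>j\<in>H. n * (cmod (x j))\<^sup>2)"
        using sum_leD[OF col F] H n by (intro mult_left_mono sum_mono mult_right_mono) auto
      also have "\<dots> = n\<^sup>2 * (\<Sum>j\<in>H. (cmod (x j))\<^sup>2)"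
        by (simp add: power2_eq_square mult.assoc flip: sum_distrib_left)
      also have "\<dots> \<le> n\<^sup>2 * ?r\<^sup>2"
        using sum_leD[OF ell2_sum_le[OF x] H] by (intro mult_left_mono) auto
      finally show ?thesis by (simp add: power_mult_distrib)
    qed
    \<comment> \<open>The bound does not depend on \<open>H\<close>, and the finite outer sum
      commutes with the limit along finite subsets of \<open>G\<close>.\<close>
    have "((\<lambda>H. \<Sum>i\<in>F. (cmod (\<Sum>j\<in>H. A i j * x j))\<^sup>2) \<longlongrightarrow> (\<Sum>i\<in>F. (cmod (mat_vec G A x i))\<^sup>2)) (finite_subsets_at_top G)"
      unfolding mat_vec_def
      using summ F by (intro tendsto_sum tendsto_power tendsto_norm infsum_tendsto) auto
    then show "(\<Sum>i\<in>F. (cmod (mat_vec G A x i))\<^sup>2) \<le> (n * ?r)\<^sup>2"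
      by (rule tendsto_upperbound)
         (auto intro!: eventually_finite_subsets_at_top_weakI fin)
  qed
  moreover have "mat_vec G A x i = 0" if "i \<notin> G" for i
    using that A by (simp add: mat_vec_def matrices_on_def)
  ultimately have "mat_vec G A x \<in> ell2 G" "(ell2_norm G (mat_vec G A x))\<^sup>2 \<le> (n * ?r)\<^sup>2"
    using sum_le_ell2[of G "mat_vec G A x"] by auto
  then show "mat_vec G A x \<in> ell2 G" "ell2_norm G (mat_vec G A x) \<le> n * ?r"
    using n by (auto intro: power2_le_imp_le)
qed

lemma Schur_test:
  assumes n: "0 \<le> n" and A: "A \<in> matrices_on G"
    and row: "\<And>i. i \<in> G \<Longrightarrow> sum_le G (\<lambda>j. cmod (A i j)) n"
    and col: "\<And>j. j \<in> G \<Longrightarrow> sum_le G (\<lambda>i. cmod (A i j)) n"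
  shows "A \<in> bounded_ops G" "op_norm G A \<le> n"
proof -
  show "A \<in> bounded_ops G"
    unfolding bounded_ops_def using Schur_test_vector[OF assms] A by blast
  show "op_norm G A \<le> n"
    using Schur_test_vector(3)[OF assms] n by (rule op_norm_le[rotated])
qed

section \<open>The key estimates\<close>

lemma infsum_ennreal_powr_bound:
  assumes fin: "ennreal_powr (\<Sum>\<^sub>\<infinity>j\<in>S. ennreal (g j)) p = ennreal e" and p: "0 < p" "0 \<le> e"
    and g: "\<And>j. j \<in> S \<Longrightarrow> 0 \<le> g j" and F: "finite F" "F \<subseteq> S"
  shows "sum g F powr p \<le> e"
proof -
  have "(\<Sum>\<^sub>\<infinity>j\<in>S. ennreal (g j)) \<le> ennreal (e powr (1 / p))"
    using fin ennreal_powr_le_iff[OF p] by (metis order_refl)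
  then have "sum_le S g (e powr (1 / p))" using g by (subst (asm) sum_le_ennreal_iff) auto
  then have "sum g F \<le> e powr (1 / p)" using F by (rule sum_leD)
  then have "sum g F powr p \<le> (e powr (1 / p)) powr p"
    using p F g by (intro powr_mono2 sum_nonneg) auto
  then show ?thesis using p by (simp add: powr_powr)
qed

text \<open>The exponents are conjugate since \<open>q / 2 + (2 - q) / 2 = 1\<close>. Raising
  \<open>v k powr q\<close> to the power \<open>2 / (2 - q)\<close> is where the exponents
  \<open>2 * q / (2 - q)\<close> and \<open>1 - q / 2\<close> of the admissibility condition come
  from.\<close>

lemma sum_powr_l2_weight:
  fixes a v :: "'a \<Rightarrow> real"
  assumes q: "0 < q" "q \<le> 1" and a: "\<And>k. k \<in> F \<Longrightarrow> 0 \<le> a k" and v: "\<And>k. k \<in> F \<Longrightarrow> 0 \<le> v k"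
    and s: "0 \<le> s" "(\<Sum>k\<in>F. (a k)\<^sup>2) \<le> s\<^sup>2"
  shows "(\<Sum>k\<in>F. (a k * v k) powr q)
    \<le> s powr q * (\<Sum>k\<in>F. v k powr (2 * q / (2 - q))) powr (1 - q / 2)"
proof -
  let ?p = "2 / q" and ?r = "2 / (2 - q)"
  have "(\<Sum>k\<in>F. (a k * v k) powr q) = (\<Sum>k\<in>F. a k powr q * v k powr q)"
    using a v by (intro sum.cong) (auto simp: powr_mult)
  also have "\<dots> \<le> (\<Sum>k\<in>F. (a k powr q) powr ?p) powr (1 / ?p) * (\<Sum>k\<in>F. (v k powr q) powr ?r) powr (1 / ?r)"
    using q by (intro Hoelder_inequality_sum) (auto simp: field_simps)
  also have "(\<Sum>k\<in>F. (a k powr q) powr ?p) = (\<Sum>k\<in>F. (a k)\<^sup>2)"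
    using a q by (intro sum.cong) (auto simp: powr_powr)
  also have "(\<Sum>k\<in>F. (v k powr q) powr ?r) = (\<Sum>k\<in>F. v k powr (2 * q / (2 - q)))"
    by (simp add: powr_powr mult.commute)
  also have "1 / ?r = 1 - q / 2" using q by (simp add: field_simps)
  also have "(\<Sum>k\<in>F. (a k)\<^sup>2) powr (1 / ?p) \<le> (s\<^sup>2) powr (1 / ?p)"
    using q s by (intro powr_mono2 sum_nonneg) auto
  also have "(s\<^sup>2) powr (1 / ?p) = s powr q"
    using s by (simp add: powr_powr flip: powr_numeral)
  finally show ?thesis by (simp add: mult_right_mono)
qed

text \<open>In the degenerate case \<open>n = 0\<close> also \<open>s = 0\<close>, and \<open>s / n = 0\<close> is the intended value. The lemma
  is about one row; by the symmetry of the weights it applies to columns as well.\<close>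

lemma sum_le_companion:
  fixes \<rho>' w' u' :: "'i \<Rightarrow> real"
  assumes q: "0 < q" "q \<le> 1" and \<theta>: "0 < \<theta>" and D: "0 < D"
    and w: "\<And>j. j \<in> G \<Longrightarrow> 0 < w' j" and u: "\<And>j. j \<in> G \<Longrightarrow> 0 < u' j"
    and adm: "\<And>t. 1 \<le> t \<Longrightarrow>
           (INF \<tau>\<in>{0..}.
              ennreal_powr (\<Sum>\<^sub>\<infinity>j\<in>{j\<in>G. \<rho>' j < \<tau>}. ennreal (\<bar>u' j\<bar> powr (2 * q / (2 - q))))
                (1 - q / 2)
              + ennreal t * (SUP j\<in>{j\<in>G. \<tau> \<le> \<rho>' j}. ennreal ((u' j / w' j) powr q)))
           \<le> ennreal (D * t powr (1 - \<theta>))"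
    and a: "\<And>j. j \<in> G \<Longrightarrow> 0 \<le> a j"
    and s: "0 \<le> s" "s \<le> n" "sum_le G (\<lambda>j. (a j)\<^sup>2) (s\<^sup>2)"
    and n: "sum_le G (\<lambda>j. (a j * w' j) powr q) (n powr q)"
  shows "sum_le G (\<lambda>j. (a j * u' j) powr q) (D * n powr q * (s / n) powr (q * \<theta>))"
proof (rule sum_leI)
  fix F assume F: "finite F" "F \<subseteq> G"
  let ?S = "\<lambda>F. \<Sum>j\<in>F. (a j * u' j) powr q"
  show "?S F \<le> D * n powr q * (s / n) powr (q * \<theta>)"
  proof (cases "s = 0")
    case True
    \<comment> \<open>A zero square sum annihilates the row. This also settles \<open>n = 0\<close>,
      because \<open>s \<le> n\<close>.\<close>
    have "a j = 0" if "j \<in> F" for j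
      using sum_le_point[OF s(3), of j] that F True by auto
    then show ?thesis using D by (simp add: sum.neutral)
  next
    case False
    then have sp: "0 < s" and np: "0 < n" using s by auto
    \<comment> \<open>Chosen so that \<open>s powr q * t = n powr q\<close>; the requirement
      \<open>1 \<le> t\<close> is just \<open>s \<le> n\<close>.\<close>
    define t where "t = (n / s) powr q"
    have t: "1 \<le> t" unfolding t_def using sp s q by (intro ge_one_powr_ge_zero) (auto simp: field_simps)
    \<comment> \<open>The left side is free of \<tau>, so a bound for each single threshold passes
      to the infimum in the admissibility condition.\<close>
    have "ennreal (?S F / s powr q) \<le>
        ennreal_powr (\<Sum>\<^sub>\<infinity>j\<in>{j\<in>G. \<rho>' j < \<tau>}. ennreal (\<bar>u' j\<bar> powr (2 * q / (2 - q)))) (1 - q / 2)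
        + ennreal t * (SUP j\<in>{j\<in>G. \<tau> \<le> \<rho>' j}. ennreal ((u' j / w' j) powr q))"
      (is "_ \<le> ?E + ennreal t * ?M") for \<tau>
    \<comment> \<open>An infinite term makes the right side infinite, as \<open>t\<close> is
      positive; otherwise both terms are real and the split into \<open>F1\<close> and
      \<open>F2\<close> is real arithmetic.\<close>
    proof (cases "?E = \<infinity> \<or> ?M = \<infinity>")
      case True
      then have "?E + ennreal t * ?M = \<infinity>"
      proof
        assume "?M = \<infinity>"
        then show ?thesis using t by (simp only: ennreal_mult_top infinity_ennreal_def) (simp add: ennreal_mult_top)
      qed (simp only: infinity_ennreal_def ennreal_add_eq_top simp_thms)
      then show ?thesis by (simp only: infinity_ennreal_def top_greatest)
    next
      case False
      obtain e where e: "0 \<le> e" "?E = ennreal e" using False by (cases ?E) auto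
      obtain m where m: "0 \<le> m" "?M = ennreal m" using False by (cases ?M) auto
      define F1 where "F1 = {j\<in>F. \<rho>' j < \<tau>}"
      define F2 where "F2 = {j\<in>F. \<tau> \<le> \<rho>' j}"
      have FF: "?S F = ?S F1 + ?S F2"
        unfolding F1_def F2_def using F
        by (subst sum.union_disjoint[symmetric]) (auto intro!: sum.cong)
      have sub: "finite F1" "F1 \<subseteq> G" "finite F2" "F2 \<subseteq> G" using F by (auto simp: F1_def F2_def)
      have "?S F1 \<le> s powr q * (\<Sum>k\<in>F1. u' k powr (2 * q / (2 - q))) powr (1 - q / 2)"
        using sub a less_imp_le[OF u] s sum_leD[OF s(3)] q
        by (intro sum_powr_l2_weight) auto
      also have "(\<Sum>k\<in>F1. u' k powr (2 * q / (2 - q))) = (\<Sum>k\<in>F1. \<bar>u' k\<bar> powr (2 * q / (2 - q)))"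
        using sub less_imp_le[OF u] by (intro sum.cong) (auto simp: subset_iff)
      also have "\<dots> powr (1 - q / 2) \<le> e"
        by (rule infsum_ennreal_powr_bound[OF e(2)]) (use q e F in \<open>auto simp: F1_def\<close>)
      finally have 1: "?S F1 \<le> s powr q * e" by (simp add: mult_left_mono)
      have "?S F2 \<le> (\<Sum>j\<in>F2. m * (a j * w' j) powr q)"
      proof (rule sum_mono)
        fix j assume j: "j \<in> F2"
        then have jG: "j \<in> G" using sub by auto
        have "ennreal ((u' j / w' j) powr q) \<le> ?M"
          using j F by (intro SUP_upper) (auto simp: F2_def)
        then have le: "(u' j / w' j) powr q \<le> m" using m by (simp add: ennreal_le_iff)
        have "(a j * u' j) powr q = ((u' j / w' j) * (a j * w' j)) powr q"
          using w[OF jG] by (simp add: mult.commute)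
        also have "\<dots> = (u' j / w' j) powr q * (a j * w' j) powr q"
          by (rule powr_mult)
        also have "\<dots> \<le> m * (a j * w' j) powr q"
          using le by (intro mult_right_mono) auto
        finally show "(a j * u' j) powr q \<le> m * (a j * w' j) powr q" .
      qed
      also have "\<dots> \<le> m * n powr q"
        using sum_leD[OF n] sub m by (auto simp flip: sum_distrib_left intro!: mult_left_mono)
      \<comment> \<open>By the choice of \<open>t\<close> the far part acquires the same factor
        \<open>s powr q\<close> that Hoelder's inequality gives to the near part.\<close>
      also have "\<dots> = s powr q * (t * m)"
        using sp np by (simp add: t_def powr_divide)
      finally have 2: "?S F2 \<le> s powr q * (t * m)" .
      have "?S F \<le> s powr q * (e + t * m)"
        using 1 2 FF by (simp add: distrib_left)
      then have "?S F / s powr q \<le> e + t * m" using sp by (simp add: field_simps)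
      then have "ennreal (?S F / s powr q) \<le> ennreal (e + t * m)" by (rule ennreal_leI)
      also have "\<dots> = ?E + ennreal t * ?M"
        using e m t by (simp add: ennreal_mult)
      finally show ?thesis .
    qed
    then have "ennreal (?S F / s powr q) \<le> ennreal (D * t powr (1 - \<theta>))"
      by (intro order.trans[OF _ adm[OF t]] INF_greatest)
    then have "?S F / s powr q \<le> D * t powr (1 - \<theta>)"
      using D by (subst (asm) ennreal_le_iff) auto
    then have "?S F \<le> D * (s powr q * t powr (1 - \<theta>))"
      using sp by (simp add: field_simps)
    also have "s powr q * t powr (1 - \<theta>) = n powr q * (s / n) powr (q * \<theta>)"
      using sp np by (simp add: t_def powr_powr powr_divide right_diff_distrib powr_diff)
    finally show ?thesis by (simp add: mult.assoc)
  qed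
qed

text \<open>The weight inequality splits each product term in two, one factor always carrying
  \<open>w\<close> and the other \<open>u\<close>. Keeping the row weights \<open>w'\<close> and
  \<open>u'\<close> separate from \<open>w\<close> and \<open>u\<close> lets the transposed product
  be an instance.\<close>

lemma sum_le_product_row:
  fixes a :: "'i \<Rightarrow> complex" and B :: "'i \<Rightarrow> 'i \<Rightarrow> complex" and w' u' :: "'i \<Rightarrow> real"
  assumes q: "0 < q" "q \<le> 1"
    and w: "\<And>k. k \<in> G \<Longrightarrow> 0 \<le> w' k" "\<And>k. k \<in> G \<Longrightarrow> 0 \<le> u' k"
      "\<And>k j. k \<in> G \<Longrightarrow> j \<in> G \<Longrightarrow> 0 \<le> w k j" "\<And>k j. k \<in> G \<Longrightarrow> j \<in> G \<Longrightarrow> 0 \<le> u k j"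
    and sub: "\<And>j k. j \<in> G \<Longrightarrow> k \<in> G \<Longrightarrow> w' j \<le> w' k * u k j + u' k * w k j"
    and aw: "sum_le G (\<lambda>k. (cmod (a k) * w' k) powr q) P"
    and au: "sum_le G (\<lambda>k. (cmod (a k) * u' k) powr q) P'"
    and Bw: "\<And>k. k \<in> G \<Longrightarrow> sum_le G (\<lambda>j. (cmod (B k j) * w k j) powr q) Q"
    and Bu: "\<And>k. k \<in> G \<Longrightarrow> sum_le G (\<lambda>j. (cmod (B k j) * u k j) powr q) Q'"
    and Q: "0 \<le> Q" "0 \<le> Q'"
    and summ: "\<And>j. j \<in> G \<Longrightarrow> (\<lambda>k. a k * B k j) summable_on G"
  shows "sum_le G (\<lambda>j. (cmod (\<Sum>\<^sub>\<infinity>k\<in>G. a k * B k j) * w' j) powr q) (P * Q' + P' * Q)"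
proof (rule sum_leI)
  fix F assume F: "finite F" "F \<subseteq> G"
  have fin: "(\<Sum>j\<in>F. (cmod (\<Sum>k\<in>H. a k * B k j) * w' j) powr q) \<le> P * Q' + P' * Q"
    if H: "finite H" "H \<subseteq> G" for H
  proof -
    let ?aw = "\<lambda>k. (cmod (a k) * w' k) powr q" and ?au = "\<lambda>k. (cmod (a k) * u' k) powr q"
    let ?Bw = "\<lambda>k j. (cmod (B k j) * w k j) powr q" and ?Bu = "\<lambda>k j. (cmod (B k j) * u k j) powr q"
    have "(cmod (\<Sum>k\<in>H. a k * B k j) * w' j) powr q \<le> (\<Sum>k\<in>H. ?aw k * ?Bu k j + ?au k * ?Bw k j)"
      if j: "j \<in> F" for j
    proof -
      have jG: "j \<in> G" using j F by auto
      have nn: "k \<in> H \<Longrightarrow> 0 \<le> w' k" "k \<in> H \<Longrightarrow> 0 \<le> u' k" "k \<in> H \<Longrightarrow> 0 \<le> w k j" "k \<in> H \<Longrightarrow> 0 \<le> u k j" for k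
        using w H jG by auto
      have "cmod (\<Sum>k\<in>H. a k * B k j) * w' j \<le> (\<Sum>k\<in>H. cmod (a k) * cmod (B k j)) * w' j"
        using w jG by (intro mult_right_mono order.trans[OF norm_sum]) (auto simp: norm_mult)
      also have "\<dots> \<le> (\<Sum>k\<in>H. (cmod (a k) * w' k) * (cmod (B k j) * u k j) + (cmod (a k) * u' k) * (cmod (B k j) * w k j))"
        unfolding sum_distrib_right
      proof (rule sum_mono)
        fix k assume "k \<in> H"
        then have "cmod (a k) * cmod (B k j) * w' j \<le> cmod (a k) * cmod (B k j) * (w' k * u k j + u' k * w k j)"
          using H jG by (intro mult_left_mono sub) auto
        then show "cmod (a k) * cmod (B k j) * w' j
            \<le> (cmod (a k) * w' k) * (cmod (B k j) * u k j) + (cmod (a k) * u' k) * (cmod (B k j) * w k j)"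
          by (simp add: algebra_simps)
      qed
      finally have "(cmod (\<Sum>k\<in>H. a k * B k j) * w' j) powr q
          \<le> (\<Sum>k\<in>H. (cmod (a k) * w' k) * (cmod (B k j) * u k j) + (cmod (a k) * u' k) * (cmod (B k j) * w k j)) powr q"
        using q w jG by (intro powr_mono2) auto
      \<comment> \<open>Subadditivity of the \<open>q\<close>-th power acts twice: here on the sum
        over \<open>k\<close>, next on the two summands.\<close>
      also have "\<dots> \<le> (\<Sum>k\<in>H. ((cmod (a k) * w' k) * (cmod (B k j) * u k j) + (cmod (a k) * u' k) * (cmod (B k j) * w k j)) powr q)"
        using q nn by (intro sum_powr_le) auto
      also have "\<dots> \<le> (\<Sum>k\<in>H. ((cmod (a k) * w' k) * (cmod (B k j) * u k j)) powr q + ((cmod (a k) * u' k) * (cmod (B k j) * w k j)) powr q)"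
        using q nn by (intro sum_mono add_powr_le) auto
      also have "\<dots> = (\<Sum>k\<in>H. ?aw k * ?Bu k j + ?au k * ?Bw k j)"
        using nn by (intro sum.cong arg_cong2[where f = "(+)"] powr_mult) auto
      finally show ?thesis .
    qed
    then have "(\<Sum>j\<in>F. (cmod (\<Sum>k\<in>H. a k * B k j) * w' j) powr q)
        \<le> (\<Sum>j\<in>F. \<Sum>k\<in>H. ?aw k * ?Bu k j + ?au k * ?Bw k j)" by (rule sum_mono)
    also have "\<dots> = (\<Sum>k\<in>H. ?aw k * (\<Sum>j\<in>F. ?Bu k j)) + (\<Sum>k\<in>H. ?au k * (\<Sum>j\<in>F. ?Bw k j))"
      by (subst sum.swap) (simp add: sum.distrib sum_distrib_left)
    \<comment> \<open>For fixed \<open>k\<close> the inner sum runs along row \<open>k\<close> of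
      \<open>B\<close>, whose bound is uniform in \<open>k\<close>.\<close>
    also have "\<dots> \<le> (\<Sum>k\<in>H. ?aw k * Q') + (\<Sum>k\<in>H. ?au k * Q)"
      using sum_leD[OF Bu F] sum_leD[OF Bw F] H by (intro add_mono sum_mono mult_left_mono) auto
    also have "\<dots> \<le> P * Q' + P' * Q"
      using sum_leD[OF aw H] sum_leD[OF au H] Q
      by (auto simp flip: sum_distrib_right intro!: add_mono mult_right_mono)
    finally show ?thesis .
  qed
  \<comment> \<open>With \<open>F\<close> fixed, summability of the entries lets \<open>H\<close>
    exhaust \<open>G\<close>.\<close>
  have "((\<lambda>H. \<Sum>j\<in>F. (cmod (\<Sum>k\<in>H. a k * B k j) * w' j) powr q)
      \<longlongrightarrow> (\<Sum>j\<in>F. (cmod (\<Sum>\<^sub>\<infinity>k\<in>G. a k * B k j) * w' j) powr q)) (finite_subsets_at_top G)"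
    using summ F q w by (intro tendsto_sum tendsto_powr2 tendsto_mult tendsto_norm infsum_tendsto) auto
  then show "(\<Sum>j\<in>F. (cmod (\<Sum>\<^sub>\<infinity>k\<in>G. a k * B k j) * w' j) powr q) \<le> P * Q' + P' * Q"
    by (rule tendsto_upperbound) (auto intro!: eventually_finite_subsets_at_top_weakI fin)
qed

section \<open>The algebra\<close>

lemma powr_le_cancel2:
  fixes x y q :: real
  assumes "x powr q \<le> y powr q" "0 < q" "0 \<le> y"
  shows "x \<le> y"
  using powr_less_mono2[of q y x] assms by force

lemma schur_le_mono: "schur_le G q w A c \<Longrightarrow> c \<le> d \<Longrightarrow> schur_le G q w A d"
  unfolding schur_le_def by (meson order.trans sum_le_mono)

text \<open>A Fatou property: each finite partial sum is continuous in the entries, so the bound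
  survives entrywise limits. The value \<open>0 \<le> c\<close> is read off from any index at which
  the bound holds.\<close>

lemma schur_le_limit:
  assumes q: "0 < q" and w: "\<And>i j. i \<in> G \<Longrightarrow> j \<in> G \<Longrightarrow> 0 \<le> w i j"
    and A: "eventually (\<lambda>m. schur_le G q w (A m) c) sequentially"
    and lim: "\<And>i j. (\<lambda>m. A m i j) \<longlonglongrightarrow> L i j"
  shows "schur_le G q w L c"
proof -
  have "sum_le G (\<lambda>j. (cmod (L i j) * w i j) powr q) c" "sum_le G (\<lambda>j. (cmod (L j i) * w j i) powr q) c"
    if i: "i \<in> G" for i
  proof -
    show "sum_le G (\<lambda>j. (cmod (L i j) * w i j) powr q) c"
    proof (rule sum_leI)
      fix F assume F: "finite F" "F \<subseteq> G"
      have "(\<lambda>m. \<Sum>j\<in>F. (cmod (A m i j) * w i j) powr q) \<longlonglongrightarrow> (\<Sum>j\<in>F. (cmod (L i j) * w i j) powr q)"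
        using q w i F
        by (intro tendsto_sum tendsto_powr2 tendsto_mult tendsto_norm lim tendsto_const) auto
      then show "(\<Sum>j\<in>F. (cmod (L i j) * w i j) powr q) \<le> c"
        by (rule tendsto_upperbound)
           (use A i F in \<open>auto elim!: eventually_mono simp: schur_le_def sum_le_def\<close>)
    qed
    show "sum_le G (\<lambda>j. (cmod (L j i) * w j i) powr q) c"
    proof (rule sum_leI)
      fix F assume F: "finite F" "F \<subseteq> G"
      have "(\<lambda>m. \<Sum>j\<in>F. (cmod (A m j i) * w j i) powr q) \<longlonglongrightarrow> (\<Sum>j\<in>F. (cmod (L j i) * w j i) powr q)"
        using q w i F
        by (intro tendsto_sum tendsto_powr2 tendsto_mult tendsto_norm lim tendsto_const) auto
      then show "(\<Sum>j\<in>F. (cmod (L j i) * w j i) powr q) \<le> c"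
        by (rule tendsto_upperbound)
           (use A i F in \<open>auto elim!: eventually_mono simp: schur_le_def sum_le_def\<close>)
    qed
  qed
  moreover have "0 \<le> c" using A eventually_happens'[OF sequentially_bot A] by (auto simp: schur_le_def)
  ultimately show ?thesis by (auto simp: schur_le_def)
qed

section \<open>Linear structure of the class and its \<open>q\<close>-norm\<close>

locale gs_weight =
  fixes G :: "'i set" and q :: real and w :: "'i \<Rightarrow> 'i \<Rightarrow> real"
  assumes q_pos: "0 < q" and q_le_1: "q \<le> 1" and weight: "coupling_weight G w"
begin

abbreviation "\<A> \<equiv> gs_class G q w"
abbreviation "N \<equiv> gs_norm G q w"

lemma w_ge_1: "i \<in> G \<Longrightarrow> j \<in> G \<Longrightarrow> 1 \<le> w i j"
  and w_sym: "i \<in> G \<Longrightarrow> j \<in> G \<Longrightarrow> w i j = w j i"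
  using weight by (auto simp: coupling_weight_def)

lemma w_nonneg: "i \<in> G \<Longrightarrow> j \<in> G \<Longrightarrow> 0 \<le> w i j"
  using w_ge_1 by fastforce

lemma schur_le_norm: "A \<in> \<A> \<Longrightarrow> schur_le G q w A (N A powr q)"
  by (rule gs_class_schur_le[OF q_pos w_nonneg])

lemma classI: "A \<in> matrices_on G \<Longrightarrow> schur_le G q w A c \<Longrightarrow> A \<in> \<A>"
  and norm_powr_le: "A \<in> matrices_on G \<Longrightarrow> schur_le G q w A c \<Longrightarrow> N A powr q \<le> c"
  by (rule schur_le_gs_class[OF q_pos w_nonneg]; assumption)+

lemma class_matrices: "A \<in> \<A> \<Longrightarrow> A \<in> matrices_on G"
  by (simp add: gs_class_def)

lemma schur_le_add:
  assumes "schur_le G q w A c" "schur_le G q w B d"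
  shows "schur_le G q w (A + B) (c + d)"
proof -
  have *: "(cmod ((A + B) i j) * w i j) powr q \<le> (cmod (A i j) * w i j) powr q + (cmod (B i j) * w i j) powr q"
    if "i \<in> G" "j \<in> G" for i j
  proof -
    have "(cmod ((A + B) i j) * w i j) powr q \<le> (cmod (A i j) * w i j + cmod (B i j) * w i j) powr q"
      using w_nonneg[OF that] q_pos
      by (intro powr_mono2) (auto simp: mult_right_mono norm_triangle_ineq simp flip: distrib_right)
    also have "\<dots> \<le> (cmod (A i j) * w i j) powr q + (cmod (B i j) * w i j) powr q"
      using w_nonneg[OF that] q_pos q_le_1 by (intro add_powr_le) auto
    finally show ?thesis .
  qed
  have **: "sum_le G h (c + d)" if "sum_le G f c" "sum_le G g d" "\<And>j. j \<in> G \<Longrightarrow> h j \<le> f j + g j" for f g h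
  proof (rule sum_leI)
    fix F assume F: "finite F" "F \<subseteq> G"
    have "sum h F \<le> sum f F + sum g F"
      using that(3) F by (subst sum.distrib[symmetric]) (auto intro!: sum_mono)
    then show "sum h F \<le> c + d" using sum_leD[OF that(1) F] sum_leD[OF that(2) F] by linarith
  qed
  show ?thesis unfolding schur_le_def
  proof (intro conjI ballI)
    show "0 \<le> c + d" using assms by (auto simp: schur_le_def)
  next
    fix i assume "i \<in> G"
    then show "sum_le G (\<lambda>j. (cmod ((A + B) i j) * w i j) powr q) (c + d)"
      using assms by (intro **[OF _ _ *]) (auto simp: schur_le_def)
  next
    fix i assume "i \<in> G"
    then show "sum_le G (\<lambda>j. (cmod ((A + B) j i) * w j i) powr q) (c + d)"
      using assms by (intro **[OF _ _ *]) (auto simp: schur_le_def)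
  qed
qed

lemma schur_le_smult:
  assumes "schur_le G q w A c"
  shows "schur_le G q w (mat_smult z A) (cmod z powr q * c)"
proof -
  have "(cmod (mat_smult z A i j) * w i j) powr q = cmod z powr q * (cmod (A i j) * w i j) powr q"
    if "i \<in> G" "j \<in> G" for i j
    using w_nonneg[OF that] by (simp add: mat_smult_def norm_mult powr_mult mult.assoc)
  then show ?thesis using assms
    by (auto simp: schur_le_def sum_le_def subset_iff mult_left_mono simp flip: sum_distrib_left)
qed

lemma norm_zero: "N 0 = 0" and zero_in: "0 \<in> \<A>"
proof -
  have "schur_le G q w 0 0" "0 \<in> matrices_on G" 
    by (auto simp: schur_le_def sum_le_def matrices_on_def)
  then show "0 \<in> \<A>" "N 0 = 0" using classI norm_powr_le[of 0 0] by auto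
qed

lemma add_in: "A \<in> \<A> \<Longrightarrow> B \<in> \<A> \<Longrightarrow> A + B \<in> \<A>"
  and norm_add: "A \<in> \<A> \<Longrightarrow> B \<in> \<A> \<Longrightarrow> N (A + B) powr q \<le> N A powr q + N B powr q"
proof -
  assume AB: "A \<in> \<A>" "B \<in> \<A>"
  have m: "A + B \<in> matrices_on G"
    using class_matrices[OF AB(1)] class_matrices[OF AB(2)] by (simp add: matrices_on_def)
  have s: "schur_le G q w (A + B) (N A powr q + N B powr q)"
    by (intro schur_le_add schur_le_norm AB)
  show "A + B \<in> \<A>" "N (A + B) powr q \<le> N A powr q + N B powr q"
    using classI[OF m s] norm_powr_le[OF m s] by auto
qed

lemma smult_in: "A \<in> \<A> \<Longrightarrow> mat_smult z A \<in> \<A>"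
  and norm_smult_le: "A \<in> \<A> \<Longrightarrow> N (mat_smult z A) \<le> cmod z * N A"
proof -
  assume A: "A \<in> \<A>"
  then have m: "mat_smult z A \<in> matrices_on G"
    using class_matrices[OF A] by (simp add: matrices_on_def mat_smult_def)
  then show "mat_smult z A \<in> \<A>" by (rule classI[OF _ schur_le_smult[OF schur_le_norm[OF A]]])
  have le: "N (mat_smult z A) powr q \<le> cmod z powr q * N A powr q"
    by (rule norm_powr_le[OF m schur_le_smult[OF schur_le_norm[OF A]]])
  show "N (mat_smult z A) \<le> cmod z * N A"
    by (rule powr_le_cancel2[of _ q]) (simp_all only: powr_mult le q_pos gs_norm_nonneg norm_ge_zero mult_nonneg_nonneg)
qed

text \<open>The reverse inequality is \<open>norm_smult_le\<close> for the scalar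
  \<open>inverse z\<close>, applied to \<open>mat_smult z A\<close>.\<close>

lemma norm_smult:
  assumes A: "A \<in> \<A>"
  shows "N (mat_smult z A) = cmod z * N A"
proof (cases "z = 0")
  case True
  then have "mat_smult z A = 0" by (auto simp: mat_smult_def fun_eq_iff)
  then show ?thesis using True norm_zero by simp
next
  case False
  have "mat_smult (inverse z) (mat_smult z A) = A"
    using False by (auto simp: mat_smult_def fun_eq_iff)
  then have "N A \<le> cmod (inverse z) * N (mat_smult z A)"
    using norm_smult_le[OF smult_in[OF A], of "inverse z" z] by simp
  then have "cmod z * N A \<le> N (mat_smult z A)" using False by (simp add: norm_divide field_simps)
  then show ?thesis using norm_smult_le[OF A, of z] by simp
qed

lemma norm_entry:
  assumes A: "A \<in> \<A>"
  shows "cmod (A i j) \<le> N A"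
proof (cases "i \<in> G \<and> j \<in> G")
  case True
  then have "(cmod (A i j) * w i j) powr q \<le> N A powr q"
    using schur_le_norm[OF A] sum_le_point[of G "\<lambda>j. (cmod (A i j) * w i j) powr q" _ j]
    by (auto simp: schur_le_def)
  then have "cmod (A i j) * w i j \<le> N A"
    using q_pos gs_norm_nonneg by (rule powr_le_cancel2)
  moreover have "cmod (A i j) * 1 \<le> cmod (A i j) * w i j"
    using w_ge_1 True by (intro mult_left_mono) auto
  ultimately show ?thesis by simp
next
  case False
  then show ?thesis using class_matrices[OF A] by (auto simp: matrices_on_def gs_norm_nonneg)
qed

lemma norm_eq_0_iff: "A \<in> \<A> \<Longrightarrow> N A = 0 \<longleftrightarrow> A = 0"
proof
  assume "A \<in> \<A>" "N A = 0"
  then show "A = 0" using norm_entry[of A] by (simp add: fun_eq_iff)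
qed (simp add: norm_zero)

lemma norm_diff_commute: "N (A - B) = N (B - A)"
  by (simp add: gs_norm_def gs_ennnorm_def norm_minus_commute)

lemma diff_in: "A \<in> \<A> \<Longrightarrow> B \<in> \<A> \<Longrightarrow> A - B \<in> \<A>"
proof -
  assume AB: "A \<in> \<A>" "B \<in> \<A>"
  have "A - B = A + mat_smult (-1) B" by (auto simp: mat_smult_def fun_eq_iff)
  then show ?thesis using add_in smult_in AB by metis
qed

section \<open>Completeness in the metric given by the \<open>q\<close>-th power of the norm\<close>

lemma Metric_space_class: "Metric_space \<A> (\<lambda>A B. N (A - B) powr q)"
proof
  fix A B C
  show "0 \<le> N (A - B) powr q" by simp
  show "N (A - B) powr q = N (B - A) powr q" by (simp add: norm_diff_commute)
  assume AB: "A \<in> \<A>" "B \<in> \<A>"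
  then show "N (A - B) powr q = 0 \<longleftrightarrow> A = B" using norm_eq_0_iff[OF diff_in[OF AB]] by simp
  assume C: "C \<in> \<A>"
  have "A - C = (A - B) + (B - C)" by simp
  then show "N (A - C) powr q \<le> N (A - B) powr q + N (B - C) powr q"
    using norm_add[OF diff_in[OF AB] diff_in[OF AB(2) C]] by (simp only:)
qed

lemma mcomplete_class: "Metric_space.mcomplete \<A> (\<lambda>A B. N (A - B) powr q)"
proof -
  interpret M: Metric_space \<A> "\<lambda>A B. N (A - B) powr q" by (rule Metric_space_class)
  have "\<exists>L. limitin M.mtopology \<sigma> L sequentially" if \<sigma>: "M.MCauchy \<sigma>" for \<sigma>
  proof -
    have in_A: "\<sigma> n \<in> \<A>" for n using \<sigma> by (auto simp: M.MCauchy_def)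
    have cauchy: "\<exists>M. \<forall>n\<ge>M. \<forall>m\<ge>M. N (\<sigma> n - \<sigma> m) powr q < \<epsilon>" if "\<epsilon> > 0" for \<epsilon>
      using \<sigma> that unfolding M.MCauchy_def by meson
    have "Cauchy (\<lambda>n. \<sigma> n i j)" for i j
    proof (rule metric_CauchyI)
      fix e :: real assume "e > 0"
      \<comment> \<open>The metric is a \<open>q\<close>-th power, so entries within
        \<open>e\<close> require the tolerance \<open>e powr q\<close>.\<close>
      then obtain M where M: "\<And>n m. n \<ge> M \<Longrightarrow> m \<ge> M \<Longrightarrow> N (\<sigma> n - \<sigma> m) powr q < e powr q"
        using cauchy[of "e powr q"] by auto
      have "dist (\<sigma> n i j) (\<sigma> m i j) < e" if "n \<ge> M" "m \<ge> M" for n m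
      proof -
        have "N (\<sigma> n - \<sigma> m) < e"
          using M[OF that] powr_mono2[of q e "N (\<sigma> n - \<sigma> m)"] q_pos \<open>e > 0\<close> by force
        then show ?thesis
          using norm_entry[OF diff_in[OF in_A in_A], of n m i j] by (simp add: dist_norm)
      qed
      then show "\<exists>M. \<forall>m\<ge>M. \<forall>n\<ge>M. dist (\<sigma> m i j) (\<sigma> n i j) < e" by blast
    qed
    then obtain L where L: "\<And>i j. (\<lambda>n. \<sigma> n i j) \<longlonglongrightarrow> L i j"
      unfolding Cauchy_convergent_iff convergent_def by metis
    have "L i j = 0" if "i \<notin> G \<or> j \<notin> G" for i j
    proof -
      have "(\<lambda>n. \<sigma> n i j) = (\<lambda>n. 0)"
        using class_matrices[OF in_A] that by (auto simp: matrices_on_def)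
      then show ?thesis using L[of i j] by (simp add: LIMSEQ_const_iff)
    qed
    then have L_mat: "L \<in> matrices_on G" by (simp add: matrices_on_def)
    have close: "\<exists>M. \<forall>n\<ge>M. schur_le G q w (\<sigma> n - L) \<epsilon>" if \<epsilon>: "\<epsilon> > 0" for \<epsilon>
    proof -
      obtain M where M: "\<And>n m. n \<ge> M \<Longrightarrow> m \<ge> M \<Longrightarrow> N (\<sigma> n - \<sigma> m) powr q < \<epsilon>"
        using cauchy[OF \<epsilon>] by auto
      have "schur_le G q w (\<sigma> n - L) \<epsilon>" if n: "n \<ge> M" for n
      \<comment> \<open>With \<open>n\<close> fixed, \<open>m\<close> tends to infinity in the
        Cauchy estimate; entrywise convergence to \<open>L\<close> suffices.\<close>
      proof (rule schur_le_limit[OF q_pos w_nonneg])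
        have "schur_le G q w (\<sigma> n - \<sigma> m) \<epsilon>" if "m \<ge> M" for m
          by (rule schur_le_mono[OF schur_le_norm[OF diff_in[OF in_A in_A]] less_imp_le[OF M[OF n that]]])
        then show "\<forall>\<^sub>F m in sequentially. schur_le G q w (\<sigma> n - \<sigma> m) \<epsilon>"
          unfolding eventually_sequentially by blast
        show "(\<lambda>m. (\<sigma> n - \<sigma> m) i j) \<longlonglongrightarrow> (\<sigma> n - L) i j" for i j
          by (auto intro!: tendsto_diff L)
      qed auto
      then show ?thesis by blast
    qed
    have diff_mat: "\<sigma> n - L \<in> matrices_on G" for n
      using class_matrices[OF in_A, of n] L_mat by (auto simp: matrices_on_def)
    obtain n where "schur_le G q w (\<sigma> n - L) 1" using close[of 1] by auto
    then have "\<sigma> n - L \<in> \<A>" by (rule classI[OF diff_mat])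
    \<comment> \<open>Membership of the limit: it is the difference of two matrices already known to
      be in the class.\<close>
    then have "\<sigma> n - (\<sigma> n - L) \<in> \<A>" using diff_in in_A by blast
    then have LA: "L \<in> \<A>" by simp
    have "limitin M.mtopology \<sigma> L sequentially"
      unfolding M.limit_metric_sequentially
    proof (intro conjI allI impI LA)
      fix \<epsilon> :: real assume "\<epsilon> > 0"
      \<comment> \<open>Half of \<epsilon>, because \<open>schur_le\<close> yields only a non-strict
        bound.\<close>
      then obtain M where "\<forall>n\<ge>M. schur_le G q w (\<sigma> n - L) (\<epsilon> / 2)"
        using close[of "\<epsilon> / 2"] by auto
      then have "\<forall>n\<ge>M. N (\<sigma> n - L) powr q \<le> \<epsilon> / 2" using norm_powr_le[OF diff_mat] by blast
      then show "\<exists>M. \<forall>n\<ge>M. \<sigma> n \<in> \<A> \<and> N (\<sigma> n - L) powr q < \<epsilon>"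
        using in_A \<open>\<epsilon> > 0\<close> by (intro exI[of _ M]) force
    qed
    then show ?thesis by blast
  qed
  then show ?thesis by (simp add: M.mcomplete_def)
qed

lemma q_banach_space_class: "q_banach_space G q \<A> N"
  unfolding q_banach_space_def
  by (intro conjI ballI allI subsetI q_pos q_le_1 class_matrices zero_in add_in smult_in gs_norm_nonneg
      norm_eq_0_iff norm_smult norm_add mcomplete_class)

section \<open>Unit, adjoint and embedding into the bounded operators\<close>

lemma mat_id_in: "mat_id G \<in> \<A>"
proof -
  \<comment> \<open>Rows and columns of the unit have one nonzero entry, weighted by
    \<open>w i i\<close>; this is where the bounded diagonal of the weight enters.\<close>
  obtain C where C: "\<And>i. i \<in> G \<Longrightarrow> w i i \<le> C"
    using weight by (auto simp: coupling_weight_def bdd_above_def)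
  have *: "(cmod (mat_id G i j) * w i j) powr q \<le> (if i = j then C powr q else 0)"
    if "i \<in> G" "j \<in> G" for i j
    using that C[of i] w_nonneg[of i i] q_pos by (auto simp: mat_id_def intro: powr_mono2)
  have **: "sum_le G f (C powr q)"
    if f: "\<And>j. j \<in> G \<Longrightarrow> f j \<le> (if j = i then C powr q else 0)" for f and i :: 'i
  proof (rule sum_leI)
    fix F assume F: "finite F" "F \<subseteq> G"
    have "sum f F \<le> (\<Sum>j\<in>F. if j = i then C powr q else 0)"
      using F(2) by (intro sum_mono f) blast
    also have "\<dots> \<le> C powr q" using F(1) by simp
    finally show "sum f F \<le> C powr q" .
  qed
  have "schur_le G q w (mat_id G) (C powr q)"
    unfolding schur_le_def
  proof (intro conjI ballI)
    fix i assume i: "i \<in> G"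
    show "sum_le G (\<lambda>j. (cmod (mat_id G i j) * w i j) powr q) (C powr q)"
      using *[OF i] by (intro **[of _ i]) (simp only: eq_commute[of _ i])
    show "sum_le G (\<lambda>j. (cmod (mat_id G j i) * w j i) powr q) (C powr q)"
      using *[OF _ i] by (intro **[of _ i]) blast
  qed simp
  moreover have "mat_id G \<in> matrices_on G" by (auto simp: mat_id_def matrices_on_def)
  ultimately show ?thesis by (rule classI[rotated])
qed

text \<open>Symmetry of \<open>w\<close> makes the adjoint merely exchange row and column
  sums.\<close>

lemma adj_in: "A \<in> \<A> \<Longrightarrow> mat_adj A \<in> \<A>"
  and norm_adj_le: "A \<in> \<A> \<Longrightarrow> N (mat_adj A) \<le> N A"
proof -
  assume A: "A \<in> \<A>"
  have m: "mat_adj A \<in> matrices_on G"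
    using class_matrices[OF A] by (auto simp: matrices_on_def mat_adj_def)
  have eq: "sum_le G (\<lambda>j. (cmod (A j i) * w i j) powr q) c = sum_le G (\<lambda>j. (cmod (A j i) * w j i) powr q) c"
     "sum_le G (\<lambda>j. (cmod (A i j) * w j i) powr q) c = sum_le G (\<lambda>j. (cmod (A i j) * w i j) powr q) c"
    if "i \<in> G" for i c
    using that w_sym by (auto intro!: sum_le_cong)
  have s: "schur_le G q w (mat_adj A) (N A powr q)"
    using schur_le_norm[OF A] by (simp add: schur_le_def mat_adj_def eq)
  show "mat_adj A \<in> \<A>" using classI[OF m s] .
  show "N (mat_adj A) \<le> N A"
    using norm_powr_le[OF m s] q_pos gs_norm_nonneg by (rule powr_le_cancel2)
qed

text \<open>The adjoint is an involution, so the inequality applied twice is an equality.\<close>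

lemma norm_adj: "A \<in> \<A> \<Longrightarrow> N (mat_adj A) = N A"
proof -
  assume A: "A \<in> \<A>"
  have "mat_adj (mat_adj A) = A" by (simp add: mat_adj_def)
  then show ?thesis using norm_adj_le[OF A] norm_adj_le[OF adj_in[OF A]] by simp
qed

text \<open>The inclusion of \<open>l^q\<close> in \<open>l^1\<close> with constant 1, from
  subadditivity of the \<open>q\<close>-th power on finite sums; weights at least 1 only enlarge the
  terms. It feeds the Schur test.\<close>

lemma sum_le_of_powr:
  assumes "sum_le G (\<lambda>j. (cmod (a j) * v j) powr q) (n powr q)" "\<And>j. j \<in> G \<Longrightarrow> 1 \<le> v j" "0 \<le> n"
  shows "sum_le G (\<lambda>j. cmod (a j)) n"
proof (rule sum_leI)
  fix F assume F: "finite F" "F \<subseteq> G"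
  have "(\<Sum>j\<in>F. cmod (a j)) powr q \<le> (\<Sum>j\<in>F. cmod (a j) powr q)"
    using q_pos q_le_1 by (intro sum_powr_le) auto
  also have "\<dots> \<le> (\<Sum>j\<in>F. (cmod (a j) * v j) powr q)"
  proof (intro sum_mono powr_mono2)
    fix j assume "j \<in> F"
    then show "cmod (a j) \<le> cmod (a j) * v j"
      using assms(2) F mult_left_mono[of 1 "v j" "cmod (a j)"] by auto
  qed (use q_pos in auto)
  also have "\<dots> \<le> n powr q" by (rule sum_leD[OF assms(1) F])
  finally show "(\<Sum>j\<in>F. cmod (a j)) \<le> n" using q_pos assms(3) by (rule powr_le_cancel2)
qed

lemma row_l1: "A \<in> \<A> \<Longrightarrow> i \<in> G \<Longrightarrow> sum_le G (\<lambda>j. cmod (A i j)) (N A)"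
  and column_l1: "A \<in> \<A> \<Longrightarrow> i \<in> G \<Longrightarrow> sum_le G (\<lambda>j. cmod (A j i)) (N A)"
  using schur_le_norm[of A] w_ge_1
  by (auto simp: schur_le_def gs_norm_nonneg intro: sum_le_of_powr)

lemma class_bounded_ops: "A \<in> \<A> \<Longrightarrow> A \<in> bounded_ops G"
  and op_norm_le_norm: "A \<in> \<A> \<Longrightarrow> op_norm G A \<le> N A"
proof -
  assume A: "A \<in> \<A>"
  show "A \<in> bounded_ops G" "op_norm G A \<le> N A"
    by (rule Schur_test[OF gs_norm_nonneg class_matrices[OF A] row_l1[OF A] column_l1[OF A]]; assumption)+
qed

text \<open>The row of \<open>A\<close> is absolutely summable and the entries of \<open>B\<close>
  are bounded by \<open>N B\<close>. Thus the \<open>infsum\<close> in \<open>mat_mult\<close> is a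
  genuine limit and not the default value 0.\<close>

lemma mult_summable:
  assumes A: "A \<in> \<A>" and B: "B \<in> \<A>" and i: "i \<in> G"
  shows "(\<lambda>k. A i k * B k j) summable_on G"
proof -
  have "(\<lambda>k. cmod (A i k) * N B) summable_on G"
    by (intro summable_on_cmult_left sum_le_summable[OF row_l1[OF A i]]) auto
  then have "(\<lambda>k. norm (A i k * B k j)) summable_on G"
    by (rule summable_on_comparison_test) (auto simp: norm_mult intro!: mult_left_mono norm_entry[OF B])
  then show ?thesis by (rule abs_summable_summable)
qed

end

section \<open>Products for an admissible weight with its companion\<close>

locale gs_admissible = gs_weight G q w for G :: "'i set" and q w +
  fixes \<rho> u :: "'i \<Rightarrow> 'i \<Rightarrow> real" and \<theta> D :: real
  assumes u_weight: "coupling_weight G u" and \<theta>: "0 < \<theta>" "\<theta> < 1" and D: "0 < D"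
    and w_submult: "\<And>i j k. i \<in> G \<Longrightarrow> j \<in> G \<Longrightarrow> k \<in> G \<Longrightarrow> w i j \<le> w i k * u k j + u i k * w k j"
    and adm: "\<And>t. 1 \<le> t \<Longrightarrow>
           (SUP i\<in>G. INF \<tau>\<in>{0..}.
              ennreal_powr (\<Sum>\<^sub>\<infinity>j\<in>{j\<in>G. \<rho> i j < \<tau>}. ennreal (\<bar>u i j\<bar> powr (2 * q / (2 - q))))
                (1 - q / 2)
              + ennreal t * (SUP j\<in>{j\<in>G. \<tau> \<le> \<rho> i j}. ennreal ((u i j / w i j) powr q)))
           \<le> ennreal (D * t powr (1 - \<theta>))"
begin

lemma u_ge_1: "i \<in> G \<Longrightarrow> j \<in> G \<Longrightarrow> 1 \<le> u i j"
  and u_sym: "i \<in> G \<Longrightarrow> j \<in> G \<Longrightarrow> u i j = u j i"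
  using u_weight by (auto simp: coupling_weight_def)

lemma u_nonneg: "i \<in> G \<Longrightarrow> j \<in> G \<Longrightarrow> 0 \<le> u i j"
  using u_ge_1 by fastforce

text \<open>\<open>sum_le_companion\<close> with \<open>s = op_norm G A\<close> and
  \<open>n = N A\<close>; the condition \<open>s \<le> n\<close> is
  \<open>op_norm_le_norm\<close>.\<close>

lemma schur_le_companion:
  assumes A: "A \<in> \<A>"
  shows "schur_le G q u A (D * N A powr q * (op_norm G A / N A) powr (q * \<theta>))" (is "schur_le _ _ _ _ ?c")
proof -
  have pos: "0 < w i j" "0 < u i j" if "i \<in> G" "j \<in> G" for i j
    using w_ge_1[OF that] u_ge_1[OF that] by auto
  have *: "sum_le G (\<lambda>j. (a j * u i j) powr q) ?c"
    if i: "i \<in> G" and a: "\<And>j. 0 \<le> a j" and l2: "sum_le G (\<lambda>j. (a j)\<^sup>2) ((op_norm G A)\<^sup>2)"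
      and n: "sum_le G (\<lambda>j. (a j * w i j) powr q) (N A powr q)" for a i
  proof (rule sum_le_companion[where \<rho>' = "\<rho> i" and w' = "w i" and u' = "u i"])
    fix t :: real assume "1 \<le> t"
    show "(INF \<tau>\<in>{0..}.
              ennreal_powr (\<Sum>\<^sub>\<infinity>j\<in>{j\<in>G. \<rho> i j < \<tau>}. ennreal (\<bar>u i j\<bar> powr (2 * q / (2 - q))))
                (1 - q / 2)
              + ennreal t * (SUP j\<in>{j\<in>G. \<tau> \<le> \<rho> i j}. ennreal ((u i j / w i j) powr q)))
           \<le> ennreal (D * t powr (1 - \<theta>))"
      using adm[OF \<open>1 \<le> t\<close>] i unfolding SUP_le_iff by blast
  qed (use i a l2 n q_pos q_le_1 \<theta> D pos op_norm_le_norm[OF A] op_norm_nonneg[OF class_bounded_ops[OF A]] in auto)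
  show ?thesis unfolding schur_le_def
  proof (intro conjI ballI)
    show "0 \<le> ?c" using D by simp
  next
    fix i assume i: "i \<in> G"
    show "sum_le G (\<lambda>j. (cmod (A i j) * u i j) powr q) ?c"
      using schur_le_norm[OF A] i op_norm_row[OF class_bounded_ops[OF A] i]
      by (intro *) (auto simp: schur_le_def)
  next
    fix i assume i: "i \<in> G"
    \<comment> \<open>Admissibility is stated along rows of the weights; symmetry of
      \<open>w\<close>, and of \<open>u\<close> at the end, transports it to a column of
      \<open>A\<close>.\<close>
    have "sum_le G (\<lambda>j. (cmod (A j i) * w i j) powr q) (N A powr q)
        = sum_le G (\<lambda>j. (cmod (A j i) * w j i) powr q) (N A powr q)"
      using i w_sym by (intro sum_le_cong) auto
    then have "sum_le G (\<lambda>j. (cmod (A j i) * u i j) powr q) ?c"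
      using schur_le_norm[OF A] i op_norm_column[OF class_bounded_ops[OF A] i]
      by (intro *) (auto simp: schur_le_def)
    also have "sum_le G (\<lambda>j. (cmod (A j i) * u i j) powr q) ?c = sum_le G (\<lambda>j. (cmod (A j i) * u j i) powr q) ?c"
      using i u_sym by (intro sum_le_cong) auto
    finally show "sum_le G (\<lambda>j. (cmod (A j i) * u j i) powr q) ?c" .
  qed
qed

lemma schur_le_mult:
  assumes A: "A \<in> \<A>" and B: "B \<in> \<A>"
  shows "schur_le G q w (mat_mult G A B) (D * N A powr q * N B powr q *
     ((op_norm G A / N A) powr (q * \<theta>) + (op_norm G B / N B) powr (q * \<theta>)))" (is "schur_le _ _ _ _ ?c")
proof -
  let ?uA = "D * N A powr q * (op_norm G A / N A) powr (q * \<theta>)"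
  let ?uB = "D * N B powr q * (op_norm G B / N B) powr (q * \<theta>)"
  note wA = schur_le_norm[OF A, unfolded schur_le_def] and wB = schur_le_norm[OF B, unfolded schur_le_def]
  note uA = schur_le_companion[OF A, unfolded schur_le_def] and uB = schur_le_companion[OF B, unfolded schur_le_def]
  show ?thesis unfolding schur_le_def
  proof (intro conjI ballI)
    show "0 \<le> ?c" using D by simp
  next
    fix i assume i: "i \<in> G"
    have "sum_le G (\<lambda>j. (cmod (\<Sum>\<^sub>\<infinity>k\<in>G. A i k * B k j) * w i j) powr q)
       (N A powr q * ?uB + ?uA * N B powr q)"
      by (rule sum_le_product_row[where u' = "u i" and u = u and w = w])
         (use i wA wB uA uB q_pos q_le_1 w_nonneg u_nonneg w_submult mult_summable[OF A B] in auto)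
    then show "sum_le G (\<lambda>j. (cmod (mat_mult G A B i j) * w i j) powr q) ?c"
      by (simp add: mat_mult_def algebra_simps)
  next
    fix i assume i: "i \<in> G"
    \<comment> \<open>Column \<open>i\<close> of the product is a row of the transposed product:
      \<open>B\<close> supplies the single row, \<open>A\<close> the matrix, and all weights are
      read with their arguments swapped.\<close>
    have "sum_le G (\<lambda>j. (cmod (\<Sum>\<^sub>\<infinity>k\<in>G. B k i * A j k) * w j i) powr q)
       (N B powr q * ?uA + ?uB * N A powr q)"
    proof (rule sum_le_product_row[where u' = "\<lambda>j. u j i" and u = "\<lambda>k j. u j k" and w = "\<lambda>k j. w j k" and B = "\<lambda>k j. A j k"])
      show "w j i \<le> w k i * u j k + u k i * w j k" if "j \<in> G" "k \<in> G" for j k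
        using w_submult[OF that(1) i that(2)] by (simp add: mult.commute add.commute)
      show "(\<lambda>k. B k i * A j k) summable_on G" if "j \<in> G" for j
        using mult_summable[OF A B that] by (simp add: mult.commute)
    qed (use i wA wB uA uB q_pos q_le_1 w_nonneg u_nonneg in auto)
    then show "sum_le G (\<lambda>j. (cmod (mat_mult G A B j i) * w j i) powr q) ?c"
      by (simp add: mat_mult_def algebra_simps)
  qed
qed

lemma mult_in: "A \<in> \<A> \<Longrightarrow> B \<in> \<A> \<Longrightarrow> mat_mult G A B \<in> \<A>"
  and norm_mult_powr_le: "A \<in> \<A> \<Longrightarrow> B \<in> \<A> \<Longrightarrow> N (mat_mult G A B) powr q \<le> D * N A powr q * N B powr q *
     ((op_norm G A / N A) powr (q * \<theta>) + (op_norm G B / N B) powr (q * \<theta>))"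
proof -
  assume AB: "A \<in> \<A>" "B \<in> \<A>"
  have m: "mat_mult G A B \<in> matrices_on G"
    using class_matrices[OF AB(1)] class_matrices[OF AB(2)] by (auto simp: matrices_on_def mat_mult_def)
  show "mat_mult G A B \<in> \<A>" "N (mat_mult G A B) powr q \<le> D * N A powr q * N B powr q *
     ((op_norm G A / N A) powr (q * \<theta>) + (op_norm G B / N B) powr (q * \<theta>))"
    using classI[OF m schur_le_mult[OF AB]] norm_powr_le[OF m schur_le_mult[OF AB]] by auto
qed

lemma norm_mult_le:
  assumes A: "A \<in> \<A>" and B: "B \<in> \<A>"
  shows "N (mat_mult G A B) \<le> (2 * D) powr (1 / q) * N A * N B"
proof -
  \<comment> \<open>Both ratios are at most 1 (a zero norm gives ratio 0), so the bracket is at most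
    2; this is the origin of \<open>(2 * D) powr (1 / q)\<close>.\<close>
  have "(op_norm G C / N C) powr (q * \<theta>) \<le> 1" if C: "C \<in> \<A>" for C
    using op_norm_le_norm[OF C] op_norm_nonneg[OF class_bounded_ops[OF C]] q_pos \<theta> gs_norm_nonneg[of G q w C]
    by (intro powr_le1) (auto simp: divide_le_eq_1)
  from this[OF A] this[OF B] have "N (mat_mult G A B) powr q \<le> D * N A powr q * N B powr q * (1 + 1)"
    using D by (intro order.trans[OF norm_mult_powr_le[OF A B]] mult_left_mono add_mono) auto
  also have "\<dots> = ((2 * D) powr (1 / q) * N A * N B) powr q"
    using q_pos D by (simp add: powr_mult powr_powr gs_norm_nonneg)
  finally show ?thesis
    using q_pos by (rule powr_le_cancel2) (simp add: gs_norm_nonneg)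
qed

lemma proper_q_banach_subalgebra_class: "proper_q_banach_subalgebra G q \<A> N"
  unfolding proper_q_banach_subalgebra_def q_banach_algebra_def
proof (intro conjI ballI)
  show "\<exists>K>0. \<forall>A\<in>\<A>. \<forall>B\<in>\<A>. mat_mult_defined G A B \<and> mat_mult G A B \<in> \<A> \<and> N (mat_mult G A B) \<le> K * N A * N B"
    unfolding mat_mult_defined_def
    by (intro exI[of _ "(2 * D) powr (1 / q)"] conjI ballI mult_in norm_mult_le mult_summable) (use D in auto)
  show "\<exists>\<theta> D. 0 < \<theta> \<and> \<theta> \<le> 1 \<and> 0 < D \<and>
        (\<forall>A\<in>\<A>. \<forall>B\<in>\<A>.
           N (mat_mult G A B) powr q \<le>
             D * N A powr q * N B powr q *
             ((op_norm G A / N A) powr (q * \<theta>) + (op_norm G B / N B) powr (q * \<theta>)))"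
    by (intro exI[of _ \<theta>] exI[of _ D] conjI ballI norm_mult_powr_le) (use \<theta> D in auto)
qed (intro subsetI q_banach_space_class mat_id_in adj_in norm_adj class_bounded_ops op_norm_le_norm; assumption)+

end

theorem theorem6p1:
  fixes G :: "(int ^ 'd) set"
    and \<rho> w :: "int ^ 'd \<Rightarrow> int ^ 'd \<Rightarrow> real"
    and q :: real
  assumes "0 < q" and "q \<le> 1"
    and "quasi_distance G \<rho>"
    and "coupling_weight G w"
    and "admissible_weight G \<rho> q w"
  shows "proper_q_banach_subalgebra G q (gs_class G q w) (gs_norm G q w)"
proof -
  obtain u \<theta> D where *: "coupling_weight G u \<and> 0 < \<theta> \<and> \<theta> < 1 \<and> 0 < D \<and>
        (\<forall>i\<in>G. \<forall>j\<in>G. \<forall>k\<in>G. w i j \<le> w i k * u k j + u i k * w k j) \<and>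
        (\<forall>t\<ge>1.
           (SUP i\<in>G. INF \<tau>\<in>{0..}.
              ennreal_powr (\<Sum>\<^sub>\<infinity>j\<in>{j\<in>G. \<rho> i j < \<tau>}. ennreal (\<bar>u i j\<bar> powr (2 * q / (2 - q))))
                (1 - q / 2)
              + ennreal t * (SUP j\<in>{j\<in>G. \<tau> \<le> \<rho> i j}. ennreal ((u i j / w i j) powr q)))
           \<le> ennreal (D * t powr (1 - \<theta>)))"
    using assms(5) unfolding admissible_weight_def by (elim exE)
  interpret gs_weight G q w
    using assms by unfold_locales
  interpret gs_admissible G q w \<rho> u \<theta> D
    by unfold_locales (use * in \<open>simp_all only: simp_thms\<close>)
  show ?thesis by (rule proper_q_banach_subalgebra_class)
qed

end
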